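(* Let $\mathcal A,\mathcal B$ be unital $C^*$-algebras with faithful traces $\tau,\omega$, respectively, and let $\phi:\mathcal D_\tau^{-1}(\mathcal A)\to\mathcal D_\omega^{-1}(\mathcal B)$ be a surjective map satisfying \[ S_U^\omega(\phi(A)\|\phi(B))=S_{BS}^\tau(A\|B)\quad\text{for all }A,B\in\mathcal D_\tau^{-1}(\mathcal A). \] Then $\mathcal A$ and $\mathcal B$ are commutative (so $S_U$ and $S_{BS}$ coincide), and $\phi(A)=CJ(A)$ for all $A\in\mathcal D_\tau^{-1}(\mathcal A)$, where $C\in\mathcal B_+^{-1}$ is central and $J:\mathcal A\to\mathcal B$ is an algebra *-isomorphism with $\omega(CJ(X))=\tau(X)$ for all $X\in\mathcal A$.
   Context: All $C^*$-algebras are unital; $\mathcal A_+^{-1}$ is the set of positive invertible elements. A trace $\tau$ is a positive linear functional with $\tau(AB)=\tau(BA)$; faithful means $\tau(A)=0$, $A\ge0$ implies $A=0$. $\mathcal D_\tau^{-1}(\mathcal A)=\{A\in\mathcal A_+^{-1}:\tau(A)=1\}$. $S_U^\tau(A\|B)=\tau(A(\log A-\log B))$ (Umegaki) and $S_{BS}^\tau(A\|B)=\tau\big(A\log(A^{1/2}B^{-1}A^{1/2})\big)$ (Belavkin–Staszewski). *)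

theory Defs
  imports Complex_Main
begin

text \<open>A unital (nonzero) complex C*-algebra is modelled as a real unital Banach algebra
  (type class real_normed_algebra_1 + banach, which gives norm 1 = 1 and submultiplicativity)
  together with an involution st satisfying the C*-identity and a central element j with
  j*j = -1 and st j = -j, which provides the complex scalar multiplication
  (a + b i) x = a x + b (j x).\<close>

definition cstar_algebra :: "('a::{real_normed_algebra_1,banach} \<Rightarrow> 'a) \<Rightarrow> 'a \<Rightarrow> bool" where
  "cstar_algebra st j \<longleftrightarrow>
     (\<forall>x y. st (x + y) = st x + st y) \<and>
     (\<forall>r x. st (scaleR r x) = scaleR r (st x)) \<and>
     (\<forall>x y. st (x * y) = st y * st x) \<and>
     (\<forall>x. st (st x) = x) \<and>
     (\<forall>x. norm (st x * x) = (norm x)^2) \<and>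
     (\<forall>x. j * x = x * j) \<and> j * j = - 1 \<and> st j = - j"

definition cpos :: "('a::{real_normed_algebra_1,banach} \<Rightarrow> 'a) \<Rightarrow> 'a \<Rightarrow> bool" where
  "cpos st x \<longleftrightarrow> (\<exists>b. x = st b * b)"

definition cinvertible :: "'a::{real_normed_algebra_1,banach} \<Rightarrow> bool" where
  "cinvertible x \<longleftrightarrow> (\<exists>y. x * y = 1 \<and> y * x = 1)"

definition cinv :: "'a::{real_normed_algebra_1,banach} \<Rightarrow> 'a" where
  "cinv x = (THE y. x * y = 1 \<and> y * x = 1)"

text \<open>Positive square root and logarithm (continuous functional calculus, characterised
  by uniqueness).\<close>
definition csqrt :: "('a::{real_normed_algebra_1,banach} \<Rightarrow> 'a) \<Rightarrow> 'a \<Rightarrow> 'a" where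
  "csqrt st x = (THE b. cpos st b \<and> b * b = x)"

definition clog :: "('a::{real_normed_algebra_1,banach} \<Rightarrow> 'a) \<Rightarrow> 'a \<Rightarrow> 'a" where
  "clog st x = (THE l. st l = l \<and> exp l = x)"

definition is_trace :: "('a::{real_normed_algebra_1,banach} \<Rightarrow> 'a) \<Rightarrow> 'a \<Rightarrow> ('a \<Rightarrow> complex) \<Rightarrow> bool" where
  "is_trace st j \<tau> \<longleftrightarrow>
     (\<forall>x y. \<tau> (x + y) = \<tau> x + \<tau> y) \<and>
     (\<forall>r x. \<tau> (scaleR r x) = complex_of_real r * \<tau> x) \<and>
     (\<forall>x. \<tau> (j * x) = \<i> * \<tau> x) \<and>
     (\<forall>x. cpos st x \<longrightarrow> Im (\<tau> x) = 0 \<and> Re (\<tau> x) \<ge> 0) \<and>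
     (\<forall>x y. \<tau> (x * y) = \<tau> (y * x))"

definition faithful_trace :: "('a::{real_normed_algebra_1,banach} \<Rightarrow> 'a) \<Rightarrow> 'a \<Rightarrow> ('a \<Rightarrow> complex) \<Rightarrow> bool" where
  "faithful_trace st j \<tau> \<longleftrightarrow> is_trace st j \<tau> \<and> (\<forall>x. cpos st x \<and> \<tau> x = 0 \<longrightarrow> x = 0)"

definition dens :: "('a::{real_normed_algebra_1,banach} \<Rightarrow> 'a) \<Rightarrow> ('a \<Rightarrow> complex) \<Rightarrow> 'a set" where
  "dens st \<tau> = {a. cpos st a \<and> cinvertible a \<and> \<tau> a = 1}"

definition S_U :: "('a::{real_normed_algebra_1,banach} \<Rightarrow> 'a) \<Rightarrow> ('a \<Rightarrow> complex) \<Rightarrow> 'a \<Rightarrow> 'a \<Rightarrow> complex" where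
  "S_U st \<tau> a b = \<tau> (a * (clog st a - clog st b))"

definition S_BS :: "('a::{real_normed_algebra_1,banach} \<Rightarrow> 'a) \<Rightarrow> ('a \<Rightarrow> complex) \<Rightarrow> 'a \<Rightarrow> 'a \<Rightarrow> complex" where
  "S_BS st \<tau> a b = \<tau> (a * clog st (csqrt st a * cinv b * csqrt st a))"

definition commutative_alg :: "'a::{real_normed_algebra_1,banach} itself \<Rightarrow> bool" where
  "commutative_alg _ \<longleftrightarrow> (\<forall>x y :: 'a. x * y = y * x)"

definition star_iso ::
  "('a::{real_normed_algebra_1,banach} \<Rightarrow> 'a) \<Rightarrow> 'a \<Rightarrow>
   ('b::{real_normed_algebra_1,banach} \<Rightarrow> 'b) \<Rightarrow> 'b \<Rightarrow> ('a \<Rightarrow> 'b) \<Rightarrow> bool" where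
  "star_iso stA jA stB jB J \<longleftrightarrow>
     bij J \<and>
     (\<forall>x y. J (x + y) = J x + J y) \<and>
     (\<forall>r x. J (scaleR r x) = scaleR r (J x)) \<and>
     (\<forall>x. J (jA * x) = jB * J x) \<and>
     (\<forall>x y. J (x * y) = J x * J y) \<and>
     J 1 = 1 \<and>
     (\<forall>x. J (stA x) = stB (J x))"

end

theory Submission
  imports Defs "HOL-Analysis.Analysis"
begin

text \<open>Write positive invertible elements as exponentials of self-adjoint ones. Since the
  trace is faithful, positivity of \<open>b\<^sup>* b\<close> and all operator inequalities can be handled under
  the trace: for self-adjoint \<open>X, Y\<close> the function \<open>t \<mapsto> \<tau> (w\<^sup>* e\<^bsup>tX\<^esup> w e\<^bsup>-tY\<^esup>)\<close> has nonnegative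
  derivatives of even order, and its convexity gives Klein's inequality and the bounds
  \<open>\<tau>(A) - \<tau>(B) \<le> S(A, B) \<le> \<tau>(A\<^sup>2 B\<^sup>-\<^sup>1) - \<tau>(A)\<close> for both entropies.

  The Umegaki entropy is affine in its first argument up to a term independent of the second one.
  Pulling this back along \<open>\<phi>\<close> and differentiating at \<open>B = 1\<close> shows that \<open>\<phi>\<close> preserves midpoints,
  and then that the two entropies coincide on \<open>A\<close>: their difference is midpoint affine and vanishes
  quadratically on the diagonal. Comparing \<open>S(A, B) + S(B, A)\<close> for \<open>A = e\<^bsup>Y + tW\<^esup>\<close>, \<open>B = e\<^bsup>Y\<^esup>\<close> up to
  order \<open>t\<^sup>2\<close>, a fourth derivative of the function above leaves the term \<open>t\<^sup>2 [Y, W]\<^sup>2\<close>, so \<open>Y\<close> and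
  \<open>W\<close> commute.

  Finally let \<open>\<phi> (D) = \<beta> 1\<close>. The map \<open>N Z = log \<phi> (D e\<^sup>Z) - log \<beta>\<close> (up to normalisation)
  satisfies \<open>\<beta> \<omega> (e\<^bsup>N W\<^esup> N Z) = \<tau> (D e\<^sup>W Z)\<close>; hence it is linear, and differentiating twice along
  \<open>t W\<close> gives \<open>N (W\<^sup>2) = (N W)\<^sup>2\<close>. A Jordan isomorphism with commutative domain has
  commutative range, so \<open>N\<close> extends to the required *-isomorphism.\<close>


section \<open>Exponential and logarithm in a real Banach algebra\<close>

lemma exp_mult_exp_minus [simp]:
  fixes x :: "'a::{real_normed_algebra_1,banach}"
  shows "exp x * exp (- x) = 1" "exp (- x) * exp x = 1"
  using exp_minus_inverse[of x] exp_minus_inverse[of "- x"] by simp_all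

lemma exp_scaleR_add:
  fixes x :: "'a::{real_normed_algebra_1,banach}"
  shows "exp (s *\<^sub>R x) * exp (t *\<^sub>R x) = exp ((s + t) *\<^sub>R x)"
  by (subst exp_add_commuting[symmetric]) (simp_all add: scaleR_add_left)

lemma exp_half_mult_self:
  fixes x :: "'a::{real_normed_algebra_1,banach}"
  shows "exp ((1/2) *\<^sub>R x) * exp ((1/2) *\<^sub>R x) = exp x"
  by (simp add: exp_scaleR_add)

lemma exp_commutes:
  fixes x z :: "'a::{real_normed_algebra_1,banach}"
  assumes "x * z = z * x"
  shows "exp x * z = z * exp x"
proof -
  have pow: "x ^ n * z = z * x ^ n" for n
    by (induction n) (simp_all add: assms mult.assoc, simp add: assms mult.assoc[symmetric])
  have "exp x * z = (\<Sum>n. (x ^ n /\<^sub>R fact n) * z)"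
    unfolding exp_def by (rule suminf_mult2[OF summable_exp_generic])
  also have "\<dots> = (\<Sum>n. z * (x ^ n /\<^sub>R fact n))"
    by (simp add: pow)
  also have "\<dots> = z * exp x"
    unfolding exp_def by (rule suminf_mult[OF summable_exp_generic])
  finally show ?thesis .
qed

lemma exp_of_real_scaleR:
  "exp (c *\<^sub>R (1::'a::{real_normed_algebra_1,banach})) = exp c *\<^sub>R 1"
  using exp_of_real[of c, where 'a='a] by (simp add: of_real_def)

lemma exp_add_scalar:
  fixes x :: "'a::{real_normed_algebra_1,banach}"
  shows "exp (x + c *\<^sub>R 1) = exp c *\<^sub>R exp x"
  by (subst exp_add_commuting) (simp_all add: exp_of_real_scaleR)

text \<open>The path \<open>exp (s a) * exp ((1 - s) b)\<close> joins \<open>exp b\<close> to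
  \<open>exp a\<close> with derivative \<open>exp (s a) * (a - b) * exp ((1 - s) b)\<close>; the two
  exponential bounds multiply to \<open>exp M\<close> for every \<open>s\<close>.\<close>

lemma exp_lipschitz:
  fixes a b :: "'a::{real_normed_algebra_1,banach}"
  assumes "norm a \<le> M" "norm b \<le> M"
  shows "norm (exp a - exp b) \<le> exp M * norm (a - b)"
proof -
  let ?h = "\<lambda>s. exp (s *\<^sub>R a) * exp ((1 - s) *\<^sub>R b)"
  let ?h' = "\<lambda>s. exp (s *\<^sub>R a) * (a - b) * exp ((1 - s) *\<^sub>R b)"
  have e: "((\<lambda>s. exp ((1 - s) *\<^sub>R b)) has_vector_derivative (-1) *\<^sub>R (b * exp ((1 - s) *\<^sub>R b))) (at s)"
    for s
  proof -
    have "((\<lambda>s. 1 - s) has_vector_derivative -1) (at s)"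
      unfolding has_real_derivative_iff_has_vector_derivative[symmetric]
      by (auto intro!: derivative_eq_intros)
    then show ?thesis
      using vector_diff_chain_at[OF _ exp_scaleR_has_vector_derivative_left] by (simp only: o_def)
  qed
  have der: "(?h has_vector_derivative ?h' s) (at s)" for s
    using has_vector_derivative_mult[OF exp_scaleR_has_vector_derivative_right[of a s UNIV] e[of s]]
    by (simp add: algebra_simps)
  have bound: "norm (?h' s) \<le> exp M * norm (a - b)" if "0 < s" "s < 1" for s
  proof -
    have "norm (s *\<^sub>R a) \<le> s * M" "norm ((1 - s) *\<^sub>R b) \<le> (1 - s) * M"
      using that assms by (auto intro: mult_left_mono)
    then have "norm (exp (s *\<^sub>R a)) \<le> exp (s * M)" "norm (exp ((1 - s) *\<^sub>R b)) \<le> exp ((1 - s) * M)"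
      by (meson exp_le_cancel_iff norm_exp order_trans)+
    then have "norm (?h' s) \<le> exp (s * M) * norm (a - b) * exp ((1 - s) * M)"
      by (intro order_trans[OF norm_mult_ineq] mult_mono) auto
    also have "\<dots> = exp M * norm (a - b)"
      by (simp add: mult_exp_exp algebra_simps)
    finally show ?thesis .
  qed
  have cont: "continuous_on {0..1} ?h"
    using der has_vector_derivative_continuous by (intro continuous_at_imp_continuous_on) blast
  have "norm (?h 1 - ?h 0) \<le> exp M * norm (a - b) * 1 - exp M * norm (a - b) * 0"
    by (rule differentiable_bound_general[where f' = ?h' and \<phi>' = "\<lambda>_. exp M * norm (a - b)"])
       (auto intro!: der bound cont continuous_intros derivative_eq_intros)
  then show ?thesis by simp
qed

lemma tendsto_exp_banach:
  fixes f :: "'b \<Rightarrow> 'a::{real_normed_algebra_1,banach}"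
  assumes "(f \<longlongrightarrow> l) F"
  shows "((\<lambda>x. exp (f x)) \<longlongrightarrow> exp l) F"
proof -
  let ?M = "norm l + 1"
  have "\<forall>\<^sub>F x in F. norm (f x - l) < 1"
    using tendstoD[OF assms, of 1] by (simp add: dist_norm)
  then have bd: "\<forall>\<^sub>F x in F. norm (exp l - exp (f x)) \<le> norm (f x - l) * exp ?M"
  proof eventually_elim
    case (elim x)
    have "norm (f x) \<le> ?M" using elim norm_triangle_ineq2[of "f x" l] by linarith
    then show ?case
      using exp_lipschitz[of l ?M "f x"] by (simp add: norm_minus_commute mult.commute)
  qed
  have "((\<lambda>x. f x - l) \<longlongrightarrow> 0) F" using assms by (simp add: LIM_zero)
  then have z: "((\<lambda>x. norm (f x - l) * exp ?M) \<longlongrightarrow> 0) F"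
    using tendsto_mult_left_zero tendsto_norm_zero by blast
  have "((\<lambda>x. exp l - exp (f x)) \<longlongrightarrow> 0) F"
    by (rule tendsto_0_le[OF z, of _ 1]) (use bd in \<open>simp add: abs_mult\<close>)
  then have "((\<lambda>x. exp l - (exp l - exp (f x))) \<longlongrightarrow> exp l - 0) F"
    by (intro tendsto_diff tendsto_const)
  then show ?thesis by simp
qed

section \<open>The logarithm series\<close>

lemma exp_log_partial_sum_derivative:
  fixes y :: "'a::{real_normed_algebra_1,banach}"
  defines "M \<equiv> \<lambda>N t. \<Sum>n<N. (t ^ Suc n / Suc n) *\<^sub>R y ^ Suc n"
  shows "((\<lambda>t. exp (M N t)) has_vector_derivative exp (M N t) * (\<Sum>n<N. t ^ n *\<^sub>R y ^ Suc n)) (at t)"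
proof (induction N)
  case 0
  then show ?case by (simp add: M_def)
next
  case (Suc N)
  have MS: "M (Suc N) t = M N t + (t ^ Suc N / Suc N) *\<^sub>R y ^ Suc N" for t by (simp add: M_def)
  have comm: "M N t * y ^ Suc N = y ^ Suc N * M N t" for t
    by (simp only: M_def sum_distrib_left sum_distrib_right mult_scaleR_left mult_scaleR_right
        power_add[symmetric] add.commute)
  \<comment> \<open>All summands are multiples of powers of \<open>y\<close> and commute, so the
    exponential factors and the product rule applies.\<close>
  have eS: "exp (M (Suc N) t) = exp (M N t) * exp ((t ^ Suc N / Suc N) *\<^sub>R y ^ Suc N)" for t
    unfolding MS by (rule exp_add_commuting) (use comm[of t] in simp)
  have d: "((\<lambda>t. t ^ Suc N / real (Suc N)) has_vector_derivative t ^ N) (at t)"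
    unfolding has_real_derivative_iff_has_vector_derivative[symmetric]
    using DERIV_cdivide[OF DERIV_pow[of "Suc N" t], of "Suc N"] by simp
  have e: "((\<lambda>t. exp ((t ^ Suc N / Suc N) *\<^sub>R y ^ Suc N)) has_vector_derivative
      t ^ N *\<^sub>R (exp ((t ^ Suc N / Suc N) *\<^sub>R y ^ Suc N) * y ^ Suc N)) (at t)"
    using vector_diff_chain_at[OF d exp_scaleR_has_vector_derivative_right] by (simp only: o_def)
  have c2: "(\<Sum>n<N. t ^ n *\<^sub>R y ^ Suc n) * exp ((t ^ Suc N / Suc N) *\<^sub>R y ^ Suc N) =
      exp ((t ^ Suc N / Suc N) *\<^sub>R y ^ Suc N) * (\<Sum>n<N. t ^ n *\<^sub>R y ^ Suc n)"
    by (rule exp_commutes[symmetric])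
       (simp only: scaleR_right.sum scaleR_left_commute[of "t ^ Suc N / Suc N"] sum_distrib_left sum_distrib_right mult_scaleR_left mult_scaleR_right
        power_add[symmetric] add.commute)
  show ?case
    unfolding eS
    by (rule has_vector_derivative_eq_rhs[OF has_vector_derivative_mult[OF Suc.IH e]])
       (simp only: sum.lessThan_Suc distrib_left mult_scaleR_right mult.assoc c2 add.commute)
qed

text \<open>The derivative of \<open>exp (M t) * (1 - t y)\<close>, where \<open>M\<close> is a partial sum of the logarithm
  series, telescopes to a single high power of \<open>y\<close>.\<close>

lemma has_log:
  fixes y :: "'a::{real_normed_algebra_1,banach}"
  assumes "norm y < 1"
  defines "l \<equiv> - (\<Sum>n. y ^ Suc n /\<^sub>R Suc n)"
  shows "exp l = 1 - y"
    and "summable (\<lambda>n. norm (y ^ Suc n /\<^sub>R Suc n))"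
proof -
  have geo: "summable (\<lambda>n. norm y ^ n)" using assms by (simp add: summable_geometric)
  show sn: "summable (\<lambda>n. norm (y ^ Suc n /\<^sub>R Suc n))"
  proof (rule summable_comparison_test'[OF geo])
    fix n
    have "norm (y ^ Suc n) \<le> norm y ^ n * 1"
      using assms by (intro order_trans[OF norm_power_ineq])
        (simp add: mult_left_le_one_le)
    moreover have "inverse (1 + real n) \<le> 1" by (simp add: field_simps)
    ultimately have "norm (y ^ Suc n) * inverse (1 + real n) \<le> norm y ^ n * 1"
      by (intro mult_mono) auto
    then show "norm (norm (y ^ Suc n /\<^sub>R Suc n)) \<le> norm y ^ n"
      by (simp add: mult.commute)
  qed
  define M where "M = (\<lambda>N t. \<Sum>n<N. (t ^ Suc n / Suc n) *\<^sub>R y ^ Suc n)"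
  define S where "S = (\<Sum>n. norm (y ^ Suc n /\<^sub>R Suc n))"
  have M1: "M N 1 = (\<Sum>n<N. y ^ Suc n /\<^sub>R Suc n)" for N
    by (simp add: M_def inverse_eq_divide)
  have Mlim: "(\<lambda>N. M N 1) \<longlonglongrightarrow> - l"
    unfolding M1 l_def minus_minus using summable_LIMSEQ[OF summable_norm_cancel[OF sn]] .
  have Mbound: "norm (M N t) \<le> S" if "0 \<le> t" "t \<le> 1" for N t
  proof -
    have "norm (M N t) \<le> (\<Sum>n<N. norm ((t ^ Suc n / Suc n) *\<^sub>R y ^ Suc n))"
      unfolding M_def by (rule norm_sum)
    also have "\<dots> \<le> (\<Sum>n<N. norm (y ^ Suc n /\<^sub>R Suc n))"
      using that power_le_one[of t "Suc _"]
      by (intro sum_mono) (auto simp: divide_inverse intro!: mult_right_mono mult_left_le_one_le simp del: power_Suc)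
    also have "\<dots> \<le> S"
      unfolding S_def by (rule sum_le_suminf[OF sn]) auto
    finally show ?thesis .
  qed
  have err: "norm (exp (M N 1) * (1 - y) - 1) \<le> exp S * norm y ^ Suc N" for N
  proof -
    let ?E = "\<lambda>t. exp (M N t) * (1 - t *\<^sub>R y)"
    let ?E' = "\<lambda>t. - (exp (M N t) * (t ^ N *\<^sub>R y ^ Suc N))"
    have tel: "(\<Sum>n<N. t ^ n *\<^sub>R y ^ Suc n) * (1 - t *\<^sub>R y) = y - t ^ N *\<^sub>R y ^ Suc N" for t
    proof (induction N)
      case 0
      then show ?case by simp
    next
      case (Suc N)
      have "t ^ N *\<^sub>R y ^ Suc N * (1 - t *\<^sub>R y) = t ^ N *\<^sub>R y ^ Suc N - t ^ Suc N *\<^sub>R y ^ Suc (Suc N)"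
        by (simp add: right_diff_distrib power_commutes mult.assoc mult.commute[where 'a = real])
      then show ?case using Suc by (simp add: distrib_right del: power_Suc)
    qed
    have d1: "((\<lambda>t. 1 - t *\<^sub>R y) has_vector_derivative - y) (at t)" for t
      by (auto intro!: derivative_eq_intros)
    have der: "(?E has_vector_derivative ?E' t) (at t)" for t
    proof (rule has_vector_derivative_eq_rhs)
      show "(?E has_vector_derivative exp (M N t) * - y +
          exp (M N t) * (\<Sum>n<N. t ^ n *\<^sub>R y ^ Suc n) * (1 - t *\<^sub>R y)) (at t)"
        using has_vector_derivative_mult[OF exp_log_partial_sum_derivative d1] unfolding M_def .
      show "exp (M N t) * - y + exp (M N t) * (\<Sum>n<N. t ^ n *\<^sub>R y ^ Suc n) * (1 - t *\<^sub>R y) = ?E' t"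
        unfolding mult.assoc tel by (simp add: algebra_simps)
    qed
    have bound: "norm (?E' t) \<le> exp S * norm y ^ Suc N" if "0 < t" "t < 1" for t
    proof -
      have 1: "norm (exp (M N t)) \<le> exp S"
        using Mbound[of t N] that norm_exp[of "M N t"] by (meson exp_le_cancel_iff less_imp_le order_trans)
      have 2: "norm (t ^ N *\<^sub>R y ^ Suc N) \<le> 1 * norm y ^ Suc N"
        using that unfolding norm_scaleR
        by (intro mult_mono norm_power_ineq) (auto simp: power_le_one)
      show ?thesis
        unfolding norm_minus_cancel
        using 1 2 by (intro order_trans[OF norm_mult_ineq] mult_mono) auto
    qed
    have cont: "continuous_on {0..1} ?E"
      using der has_vector_derivative_continuous by (intro continuous_at_imp_continuous_on) blast
    have "norm (?E 1 - ?E 0) \<le> exp S * norm y ^ Suc N * 1 - exp S * norm y ^ Suc N * 0"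
      by (rule differentiable_bound_general[where f' = ?E' and \<phi>' = "\<lambda>_. exp S * norm y ^ Suc N"])
         (use der bound cont in \<open>auto intro!: continuous_intros derivative_eq_intros\<close>)
    moreover have "M N 0 = 0" by (simp add: M_def)
    ultimately show ?thesis by simp
  qed
  have "(\<lambda>N. exp (M N 1) * (1 - y)) \<longlonglongrightarrow> exp (- l) * (1 - y)"
    by (intro tendsto_mult tendsto_exp_banach Mlim tendsto_const)
  moreover have "(\<lambda>N. exp (M N 1) * (1 - y)) \<longlonglongrightarrow> 1"
  proof (rule LIM_zero_cancel)
    have "(\<lambda>N. exp S * norm y ^ Suc N) \<longlonglongrightarrow> exp S * 0"
      using assms by (intro tendsto_mult tendsto_const LIMSEQ_Suc[of "\<lambda>n. norm y ^ n"] LIMSEQ_power_zero) auto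
    then show "(\<lambda>N. exp (M N 1) * (1 - y) - 1) \<longlonglongrightarrow> 0"
      unfolding mult_zero_right by (rule Lim_null_comparison[rotated]) (intro always_eventually allI err)
  qed
  ultimately have "exp (- l) * (1 - y) = 1" by (rule LIMSEQ_unique)
  then have "exp l * (exp (- l) * (1 - y)) = exp l" by simp
  then show "exp l = 1 - y" by (simp add: mult.assoc[symmetric])
qed

text \<open>Together with \<open>exp_commutes\<close> this stands in for the fact that functional
  calculus stays in the bicommutant.\<close>

lemma log_series_commutes:
  fixes y z :: "'a::{real_normed_algebra_1,banach}"
  assumes "norm y < 1" "y * z = z * y"
  shows "(\<Sum>n. y ^ Suc n /\<^sub>R Suc n) * z = z * (\<Sum>n. y ^ Suc n /\<^sub>R Suc n)"
proof -
  note s = summable_norm_cancel[OF has_log(2)[OF assms(1)]]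
  have pow: "y ^ n * z = z * y ^ n" for n
    by (induction n) (simp_all add: assms mult.assoc, simp add: assms mult.assoc[symmetric])
  show ?thesis
    unfolding suminf_mult2[OF s] suminf_mult[OF s, symmetric] mult_scaleR_left mult_scaleR_right pow ..
qed

text \<open>After two terms the tail is dominated by a geometric series starting at
  \<open>norm y ^ 3\<close>, whose factor \<open>1 / (1 - norm y)\<close> is at most 2.\<close>

lemma log_series_second_order:
  fixes y :: "'a::{real_normed_algebra_1,banach}"
  assumes "norm y \<le> 1/2"
  shows "norm ((\<Sum>n. y ^ Suc n /\<^sub>R Suc n) - y - (y * y) /\<^sub>R 2) \<le> 2 * norm y ^ 3"
proof -
  have y1: "norm y < 1" using assms by simp
  let ?f = "\<lambda>n. y ^ Suc n /\<^sub>R Suc n"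
  note sn = has_log(2)[OF y1] and s = summable_norm_cancel[OF has_log(2)[OF y1]]
  have eq: "(\<Sum>n. ?f n) - y - (y * y) /\<^sub>R 2 = (\<Sum>n. ?f (n + 2))"
    using suminf_split_initial_segment[OF s, of 2] by (simp add: numeral_2_eq_2)
  have geo: "(\<lambda>n. norm y ^ 3 * norm y ^ n) sums (norm y ^ 3 * (1 / (1 - norm y)))"
    using y1 by (intro sums_mult geometric_sums) simp
  have le: "norm (?f (n + 2)) \<le> norm y ^ 3 * norm y ^ n" for n
  proof -
    have "norm (?f (n + 2)) \<le> 1 * norm (y ^ Suc (n + 2))"
      unfolding norm_scaleR by (rule mult_right_mono) (auto simp: field_simps)
    also have "\<dots> \<le> norm y ^ Suc (n + 2)" using norm_power_ineq[of y "Suc (n + 2)"] by simp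
    also have "\<dots> = norm y ^ 3 * norm y ^ n"
      by (simp only: power_add[symmetric]) (simp add: numeral_3_eq_3)
    finally show ?thesis .
  qed
  have "norm (\<Sum>n. ?f (n + 2)) \<le> (\<Sum>n. norm y ^ 3 * norm y ^ n)"
    by (rule norm_suminf_le[OF le sums_summable[OF geo]])
  also have "\<dots> = norm y ^ 3 * (1 / (1 - norm y))" using geo sums_unique by metis
  also have "\<dots> \<le> norm y ^ 3 * 2"
    using assms by (intro mult_left_mono) (auto simp: field_simps)
  finally show ?thesis unfolding eq by simp
qed

section \<open>C*-algebras with a faithful trace\<close>

locale traced_cstar_algebra =
  fixes st :: "'a::{real_normed_algebra_1,banach} \<Rightarrow> 'a" and j :: 'a and \<tau> :: "'a \<Rightarrow> complex"
  assumes cstar: "cstar_algebra st j" and faithful: "faithful_trace st j \<tau>"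
begin

text \<open>The trace is real on self-adjoint elements and on products of two of them
  (\<open>tau_sa\<close>, \<open>tau_sa_mult\<close>), so passing to real calculus loses
  nothing.\<close>

definition T :: "'a \<Rightarrow> real" where "T x = Re (\<tau> x)"

definition sa :: "'a \<Rightarrow> bool" where "sa x \<longleftrightarrow> st x = x"

lemma st_add: "st (x + y) = st x + st y"
  and st_scaleR: "st (r *\<^sub>R x) = r *\<^sub>R st x"
  and st_mult: "st (x * y) = st y * st x"
  and st_st [simp]: "st (st x) = x"
  and norm_st_mult: "norm (st x * x) = (norm x)\<^sup>2"
  and j_commute: "j * x = x * j"
  and j_j: "j * j = - 1"
  and st_j: "st j = - j"
  using cstar unfolding cstar_algebra_def by blast+

lemma st_minus: "st (- x) = - st x"
  using st_scaleR[of "-1" x] by simp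

lemma st_diff: "st (x - y) = st x - st y"
  using st_add[of x "- y"] by (simp add: st_minus)

lemma st_0 [simp]: "st 0 = 0"
  using st_scaleR[of 0 0] by simp

lemma st_1 [simp]: "st 1 = 1"
  by (metis mult.left_neutral mult.right_neutral st_mult st_st)

lemma st_power: "st (x ^ n) = st x ^ n"
  by (induction n) (simp_all add: st_mult power_commutes)

lemma norm_st [simp]: "norm (st x) = norm x"
proof -
  have le: "norm x \<le> norm (st x)" for x
  proof (cases "x = 0")
    case False
    have "norm x * norm x \<le> norm (st x) * norm x"
      using norm_mult_ineq[of "st x" x] norm_st_mult[of x] by (simp add: power2_eq_square)
    then show ?thesis using False by simp
  qed simp
  show ?thesis using le[of x] le[of "st x"] by simp
qed

lemma bounded_linear_st: "bounded_linear st"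
  by (rule bounded_linear_intro[of _ 1]) (simp_all add: st_add st_scaleR)

lemma st_exp: "st (exp x) = exp (st x)"
  unfolding exp_def bounded_linear.suminf[OF bounded_linear_st summable_exp_generic]
  by (simp add: st_scaleR st_power)

lemma st_mult_self_eq_0: "st x * x = 0 \<Longrightarrow> x = 0"
  using norm_st_mult[of x] by simp

lemma norm_j: "norm j = 1"
proof -
  have "(norm j)\<^sup>2 = 1" using norm_st_mult[of j] by (simp add: st_j j_j)
  then show ?thesis by (simp add: power2_eq_1_iff) (metis norm_ge_zero not_one_le_zero
    add.inverse_inverse neg_0_le_iff_le le_minus_one_simps(3))
qed

lemma sa_st: "sa x \<Longrightarrow> st x = x"
  by (simp add: sa_def)

lemma sa_0 [simp, intro]: "sa 0"
  and sa_1 [simp, intro]: "sa 1"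
  and sa_add [intro]: "sa x \<Longrightarrow> sa y \<Longrightarrow> sa (x + y)"
  and sa_diff [intro]: "sa x \<Longrightarrow> sa y \<Longrightarrow> sa (x - y)"
  and sa_minus [intro]: "sa x \<Longrightarrow> sa (- x)"
  and sa_scaleR [intro]: "sa x \<Longrightarrow> sa (r *\<^sub>R x)"
  and sa_exp [intro]: "sa x \<Longrightarrow> sa (exp x)"
  and sa_mult_self [intro]: "sa x \<Longrightarrow> sa (x * x)"
  and sa_st_mult [intro]: "sa (st z * z)"
  and sa_sandwich [intro]: "sa x \<Longrightarrow> sa y \<Longrightarrow> sa (x * y * x)"
  by (simp_all add: sa_def st_add st_diff st_minus st_scaleR st_exp st_mult mult.assoc)

lemma sa_mult_commuting: "sa x \<Longrightarrow> sa y \<Longrightarrow> x * y = y * x \<Longrightarrow> sa (x * y)"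
  by (simp add: sa_def st_mult)

lemma st_j_mult: "st (j * x) = - (j * st x)"
  by (simp add: st_mult st_j j_commute)

lemma j_j_mult: "j * (j * x) = - x"
  by (simp add: mult.assoc[symmetric] j_j)

lemma sa_decompose:
  obtains h k where "sa h" "sa k" "x = h + j * k"
proof
  show "sa ((1/2) *\<^sub>R (x + st x))" by (simp add: sa_def st_add st_scaleR add.commute)
  show "sa ((1/2) *\<^sub>R (- (j * (x - st x))))"
    by (simp add: sa_def st_scaleR st_minus st_diff st_j_mult algebra_simps)
  have "(1/2) *\<^sub>R (x + st x) + j * ((1/2) *\<^sub>R (- (j * (x - st x)))) = (1/2) *\<^sub>R ((x + st x) + (x - st x))"
    by (simp only: mult_scaleR_right mult_minus_right j_j_mult minus_minus scaleR_right_distrib)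
  also have "(x + st x) + (x - st x) = x + x" by simp
  finally show "x = (1/2) *\<^sub>R (x + st x) + j * ((1/2) *\<^sub>R (- (j * (x - st x))))"
    by (simp only: scaleR_half_double)
qed

text \<open>Applying \<open>st\<close> shows that \<open>h - j * k\<close> vanishes too; this is
  uniqueness of the Cartesian decomposition.\<close>

lemma sa_plus_j_eq_0:
  assumes "sa h" "sa k" "h + j * k = 0"
  shows "h = 0" "k = 0"
proof -
  have "h - j * k = st (h + j * k)"
    using assms(1,2) by (simp add: st_add sa_st st_j_mult)
  then have "h = j * k" by (simp add: assms(3))
  then have "2 *\<^sub>R h = 0" using assms(3) by (simp add: scaleR_2)
  then show h: "h = 0" by simp
  then have "j * (j * k) = 0" using assms(3) by simp
  then show "k = 0" by (simp add: j_j_mult)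
qed

lemma cpos_st_mult [simp, intro]: "cpos st (st b * b)"
  by (auto simp: cpos_def)

lemma cpos_sa_square: "sa x \<Longrightarrow> cpos st (x * x)"
  by (metis cpos_st_mult sa_st)

lemma cpos_exp: "sa x \<Longrightarrow> cpos st (exp x)"
  using cpos_sa_square[of "exp ((1/2) *\<^sub>R x)"] by (simp add: exp_half_mult_self sa_exp sa_scaleR)

lemma cinvertible_exp [simp, intro]: "cinvertible (exp x)"
  unfolding cinvertible_def using exp_mult_exp_minus by blast

subsection \<open>The trace\<close>

lemma tau_add: "\<tau> (x + y) = \<tau> x + \<tau> y"
  and tau_scaleR: "\<tau> (r *\<^sub>R x) = complex_of_real r * \<tau> x"
  and tau_j: "\<tau> (j * x) = \<i> * \<tau> x"
  and tau_commute: "\<tau> (x * y) = \<tau> (y * x)"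
  and tau_cpos: "cpos st x \<Longrightarrow> Im (\<tau> x) = 0" "cpos st x \<Longrightarrow> Re (\<tau> x) \<ge> 0"
  and tau_faithful: "cpos st x \<Longrightarrow> \<tau> x = 0 \<Longrightarrow> x = 0"
  using faithful unfolding faithful_trace_def is_trace_def by blast+

lemma T_add: "T (x + y) = T x + T y"
  and T_scaleR: "T (r *\<^sub>R x) = r * T x"
  and T_commute: "T (x * y) = T (y * x)"
  by (simp_all add: T_def tau_add tau_scaleR tau_commute[of x y])

lemma T_0 [simp]: "T 0 = 0" using T_scaleR[of 0 0] by simp
lemma T_minus: "T (- x) = - T x" using T_scaleR[of "-1" x] by simp
lemma T_diff: "T (x - y) = T x - T y" using T_add[of x "- y"] by (simp add: T_minus)

lemma T_st_mult_nonneg: "T (st x * x) \<ge> 0"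
  unfolding T_def by (rule tau_cpos) auto

lemma T_st_mult_eq_0: "T (st x * x) = 0 \<Longrightarrow> x = 0"
  unfolding T_def
  by (rule st_mult_self_eq_0, rule tau_faithful) (simp_all add: complex_eq_iff tau_cpos)

lemma T_sa_square_nonneg: "sa x \<Longrightarrow> T (x * x) \<ge> 0"
  using T_st_mult_nonneg[of x] by (simp add: sa_st)

lemma T_sa_square_eq_0: "sa x \<Longrightarrow> T (x * x) = 0 \<Longrightarrow> x = 0"
  using T_st_mult_eq_0[of x] by (simp add: sa_st)

text \<open>Since 4 x = (1 + x)(1 + x) - (1 - x)(1 - x), \<open>x\<close> is a combination of
  positive elements.\<close>

lemma tau_sa: 
  assumes "sa x"
  shows "\<tau> x = complex_of_real (T x)"
proof -
  have "x = (1/4) *\<^sub>R ((1 + x) * (1 + x)) + (- 1/4) *\<^sub>R ((1 - x) * (1 - x))"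
    by (simp add: algebra_simps flip: scaleR_left.add)
  also have "\<tau> \<dots> = (1/4) * \<tau> ((1 + x) * (1 + x)) + (- 1/4) * \<tau> ((1 - x) * (1 - x))"
    by (simp only: tau_add tau_scaleR) simp
  finally have "Im (\<tau> x) = 0"
    using tau_cpos(1)[OF cpos_sa_square[of "1 + x"]] tau_cpos(1)[OF cpos_sa_square[of "1 - x"]] assms
    by (auto simp: sa_add sa_diff)
  then show ?thesis by (simp add: T_def complex_eq_iff)
qed

text \<open>The product need not be self-adjoint, but its trace is half that of the self-adjoint
  \<open>x * y + y * x\<close>.\<close>

lemma tau_sa_mult:
  assumes "sa x" "sa y"
  shows "\<tau> (x * y) = complex_of_real (T (x * y))"
proof -
  have "2 *\<^sub>R \<tau> (x * y) = \<tau> (x * y + y * x)"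
    by (simp add: tau_add tau_commute[of y x] scaleR_2)
  also have "\<dots> = complex_of_real (T (x * y + y * x))"
    using assms by (intro tau_sa) (simp add: sa_def st_add st_mult add.commute)
  also have "\<dots> = 2 *\<^sub>R complex_of_real (T (x * y))"
    by (simp add: T_add T_commute[of y x] scaleR_2)
  finally show ?thesis by simp
qed

lemma T_j_mult_sa: "sa k \<Longrightarrow> T (j * k) = 0"
  using arg_cong[OF tau_sa, of k Im] by (simp add: T_def tau_j)

lemma T_st: "T (st x) = T x"
proof -
  obtain h k where "sa h" "sa k" "x = h + j * k" by (rule sa_decompose)
  then have "st x = h - j * k" "T (j * k) = 0"
    by (simp_all add: st_add sa_st st_j_mult T_j_mult_sa)
  with \<open>x = h + j * k\<close> show ?thesis by (simp add: T_add T_diff)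
qed

subsection \<open>Square roots and logarithms\<close>

lemma sa_log_series:
  assumes "sa y" "norm y < 1"
  shows "sa (\<Sum>n. y ^ Suc n /\<^sub>R Suc n)"
proof -
  note s = summable_norm_cancel[OF has_log(2)[OF assms(2)]]
  show ?thesis
    unfolding sa_def bounded_linear.suminf[OF bounded_linear_st s]
    using sa_st[OF assms(1)] by (simp add: st_scaleR st_power del: power_Suc)
qed

text \<open>Division by \<open>r\<close> brings \<open>y\<close> into the range of the logarithm
  series. Lying in such a ball takes the place of a positive spectrum, and the commutation clause
  that of functional calculus.\<close>

lemma sa_log_ball:
  assumes "sa y" "norm (r *\<^sub>R 1 - y) < r"
  shows "\<exists>l. sa l \<and> exp l = y \<and> (\<forall>z. y * z = z * y \<longrightarrow> l * z = z * l)"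
proof -
  define v where "v = 1 - y /\<^sub>R r"
  define l where "l = - (\<Sum>n. v ^ Suc n /\<^sub>R Suc n) + ln r *\<^sub>R 1"
  have r: "r > 0" using assms(2) norm_ge_zero by (rule le_less_trans[rotated])
  have "v = (r *\<^sub>R 1 - y) /\<^sub>R r" using r by (simp add: v_def scaleR_right_diff_distrib)
  then have "norm v = norm (r *\<^sub>R 1 - y) / r" using r by (simp add: divide_inverse_commute)
  then have v1: "norm v < 1" using r assms(2) by simp
  have "sa v" using assms(1) unfolding v_def by auto
  then have "sa l" unfolding l_def using v1 sa_log_series by (intro sa_add sa_minus sa_scaleR sa_1)
  moreover have "exp l = y"
    using has_log(1)[OF v1] r unfolding l_def exp_add_scalar by (simp add: v_def)
  moreover have "l * z = z * l" if "y * z = z * y" for z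
  proof -
    have "v * z = z * v" using that by (simp add: v_def algebra_simps)
    from log_series_commutes[OF v1 this] show ?thesis by (simp add: l_def algebra_simps)
  qed
  ultimately show ?thesis by blast
qed

text \<open>With \<open>c = sqrt (1 - u * u)\<close> the element \<open>u + j * c\<close> is unitary, so \<open>c\<close> has norm at most 1.\<close>

lemma norm_one_minus_square:
  assumes "sa u" "norm u < 1"
  shows "norm (1 - u * u) \<le> 1"
proof -
  have "norm (u * u) < 1"
    using assms norm_st_mult[of u] by (simp add: sa_st power_less_one_iff abs_square_less_1)
  then have "norm (1 *\<^sub>R 1 - (1 - u * u)) < 1" by simp
  then obtain l where l: "sa l" "exp l = 1 - u * u" "\<And>z. (1 - u * u) * z = z * (1 - u * u) \<Longrightarrow> l * z = z * l"
    using sa_log_ball[of "1 - u * u" 1] assms by blast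
  define c where "c = exp ((1/2) *\<^sub>R l)"
  have c: "sa c" "c * c = 1 - u * u" unfolding c_def exp_half_mult_self using l by auto
  have "l * u = u * l" by (rule l(3)) (simp add: algebra_simps)
  then have cu: "c * u = u * c" unfolding c_def by (intro exp_commutes) simp
  define w where "w = u + j * c"
  have stw: "st w = u - j * c" using assms c by (simp add: w_def st_add sa_st st_j_mult)
  have jcjc: "(j * c) * (j * c) = - (c * c)"
    by (metis j_commute j_j mult.assoc mult_minus1)
  have "st w * w = u * u + (u * (j * c) - (j * c) * u) - (j * c) * (j * c)"
    unfolding stw unfolding w_def by (simp add: algebra_simps)
  also have "u * (j * c) = (j * c) * u" by (metis cu j_commute mult.assoc)
  finally have "st w * w = 1" using jcjc c(2) by simp
  then have nw: "norm w = 1" using norm_st_mult[of w] by (simp add: power2_eq_1_iff)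
    (metis norm_ge_zero not_one_le_zero neg_0_le_iff_le)
  \<comment> \<open>\<open>c\<close> is recovered as the imaginary part of the unitary
    \<open>w\<close>, which bounds its norm by 1.\<close>
  have "2 *\<^sub>R c = j * (st w - w)"
  proof -
    have "j * (st w - w) = - (j * (j * c)) - (j * (j * c))" unfolding stw unfolding w_def by (simp add: algebra_simps)
    then show ?thesis by (simp add: mult.assoc[symmetric] j_j scaleR_2)
  qed
  then have "2 * norm c \<le> norm (st w - w)"
    using norm_mult_ineq[of j "st w - w"] norm_j by (metis mult_1 norm_scaleR abs_numeral)
  also have "\<dots> \<le> 2" using norm_triangle_ineq4[of "st w" w] nw by simp
  finally have "norm c \<le> 1" by simp
  then have "norm (c * c) \<le> 1"
    by (meson mult_le_one norm_ge_zero norm_mult_ineq order_trans)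
  then show ?thesis by (simp add: c)
qed

text \<open>The square lies in a closed ball with 0 on its boundary; adding a positive scalar moves
  it into an open ball as in \<open>sa_log_ball\<close>.\<close>

lemma norm_scalar_minus_square:
  assumes "sa u" "norm u < r"
  shows "norm (r\<^sup>2 *\<^sub>R 1 - u * u) \<le> r\<^sup>2"
proof -
  have r: "r > 0" using assms(2) norm_ge_zero by (rule le_less_trans[rotated])
  have sq: "(u /\<^sub>R r) * (u /\<^sub>R r) = (u * u) /\<^sub>R r\<^sup>2"
    by (simp add: power2_eq_square)
  have "norm (u /\<^sub>R r) < 1" using assms(2) r by (simp add: divide_inverse_commute[symmetric])
  then have "norm (1 - (u * u) /\<^sub>R r\<^sup>2) \<le> 1"
    using norm_one_minus_square[OF sa_scaleR[OF assms(1), of "inverse r"]] unfolding sq by blast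
  then have "r\<^sup>2 * norm (1 - (u * u) /\<^sub>R r\<^sup>2) \<le> r\<^sup>2 * 1"
    by (rule mult_left_mono) simp
  then have "norm (r\<^sup>2 *\<^sub>R (1 - (u * u) /\<^sub>R r\<^sup>2)) \<le> r\<^sup>2" by simp
  moreover have "r\<^sup>2 * inverse (r\<^sup>2) = 1" using r by simp
  ultimately show ?thesis
    by (simp only: scaleR_right_diff_distrib scaleR_scaleR scaleR_one)
qed

text \<open>The square of an invertible \<open>x\<close> is bounded below by \<open>1/s\<^sup>2\<close>, where \<open>s\<close> bounds the norm
  of the inverse: \<open>s\<^sup>2 - x\<^sup>-\<^sup>2\<close> is a square \<open>g\<^sup>2\<close>, so \<open>s\<^sup>2 x\<^sup>2 - 1 = (g x)\<^sup>2\<close>.\<close>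

lemma sa_invertible_square_log:
  assumes "sa x" "x * y = 1" "y * x = 1"
  shows "\<exists>l. sa l \<and> exp l = x * x \<and> (\<forall>z. (x * x) * z = z * (x * x) \<longrightarrow> l * z = z * l)"
proof -
  have y: "sa y"
    using assms unfolding sa_def by (metis mult.assoc mult.left_neutral mult.right_neutral st_1 st_mult)
  \<comment> \<open>Strictly larger than the norm of the inverse, so that \<open>sa_log_ball\<close>
    applies to the difference below with radius \<open>s\<^sup>2\<close>.\<close>
  define s where "s = norm y + 1"
  have s: "s > 0" by (simp add: s_def add_nonneg_pos)
  have "norm (y * y) \<le> norm y * norm y" by (rule norm_mult_ineq)
  also have "\<dots> < s\<^sup>2" using power_strict_mono[of "norm y" s 2] by (simp add: s_def power2_eq_square)
  finally have "norm (s\<^sup>2 *\<^sub>R 1 - (s\<^sup>2 *\<^sub>R 1 - y * y)) < s\<^sup>2" by simp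
  then obtain l where l: "sa l" "exp l = s\<^sup>2 *\<^sub>R 1 - y * y"
      "\<And>z. (s\<^sup>2 *\<^sub>R 1 - y * y) * z = z * (s\<^sup>2 *\<^sub>R 1 - y * y) \<Longrightarrow> l * z = z * l"
    using sa_log_ball[of "s\<^sup>2 *\<^sub>R 1 - y * y"] y by blast
  define g where "g = exp ((1/2) *\<^sub>R l)"
  have g: "sa g" "g * g = s\<^sup>2 *\<^sub>R 1 - y * y" unfolding g_def exp_half_mult_self using l by auto
  have "l * x = x * l"
  proof (rule l(3))
    have "y * y * x = x * (y * y)" using assms(2,3) by (metis mult.assoc mult.left_neutral mult.right_neutral)
    then show "(s\<^sup>2 *\<^sub>R 1 - y * y) * x = x * (s\<^sup>2 *\<^sub>R 1 - y * y)" by (simp add: algebra_simps)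
  qed
  then have gx: "g * x = x * g" unfolding g_def by (intro exp_commutes) simp
  then have "sa (g * x)" using g assms by (intro sa_mult_commuting)
  moreover have sq: "(g * x) * (g * x) = s\<^sup>2 *\<^sub>R (x * x) - 1"
  proof -
    have "(g * x) * (g * x) = x * (g * g) * x" by (metis gx mult.assoc)
    also have "\<dots> = s\<^sup>2 *\<^sub>R (x * x) - (x * y) * (y * x)" unfolding g by (simp add: algebra_simps)
    finally show ?thesis by (simp add: assms)
  qed
  define R where "R = norm (g * x) + 1"
  have R: "norm (g * x) < R" "R > 0" by (simp_all add: R_def add_nonneg_pos)
  ultimately have "norm (R\<^sup>2 *\<^sub>R 1 - (g * x) * (g * x)) \<le> R\<^sup>2"
    using norm_scalar_minus_square by blast
  then have "norm (R\<^sup>2 *\<^sub>R 1 - (s\<^sup>2 *\<^sub>R (x * x) - 1)) \<le> R\<^sup>2"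
    by (simp only: sq)
  then have n: "norm ((R\<^sup>2 + 1) *\<^sub>R 1 - s\<^sup>2 *\<^sub>R (x * x)) \<le> R\<^sup>2"
    by (simp add: algebra_simps)
  \<comment> \<open>By \<open>n\<close>, division by \<open>s\<^sup>2\<close> puts
    \<open>x * x\<close> into the open ball of radius \<open>?q\<close> around
    \<open>?q\<close>.\<close>
  let ?q = "(R\<^sup>2 + 1) / s\<^sup>2"
  have "?q *\<^sub>R 1 - x * x = ((R\<^sup>2 + 1) *\<^sub>R 1 - s\<^sup>2 *\<^sub>R (x * x)) /\<^sub>R s\<^sup>2"
    using s by (simp add: scaleR_right_diff_distrib divide_inverse_commute)
  then have "norm (?q *\<^sub>R 1 - x * x) = norm ((R\<^sup>2 + 1) *\<^sub>R 1 - s\<^sup>2 *\<^sub>R (x * x)) / s\<^sup>2"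
    by (simp add: divide_inverse_commute)
  also have "\<dots> < ?q" using n s by (intro divide_strict_right_mono) auto
  finally show ?thesis using assms by (intro sa_log_ball sa_mult_self)
qed

text \<open>Kaplansky's argument: for \<open>c = \<bar>x\<bar>\<close> and \<open>f = c - x\<close> the element \<open>(b f)\<^sup>* (b f) = f x f\<close>
  is minus a square, and the trace of both is nonnegative.\<close>

lemma positive_invertible_log:
  assumes "cpos st x" "cinvertible x"
  shows "\<exists>l. sa l \<and> exp l = x"
proof -
  obtain b where b: "x = st b * b" using assms by (auto simp: cpos_def)
  obtain y where y: "x * y = 1" "y * x = 1" using assms by (auto simp: cinvertible_def)
  have x: "sa x" unfolding b by (rule sa_st_mult)
  obtain l where l: "sa l" "exp l = x * x" "\<And>z. (x * x) * z = z * (x * x) \<Longrightarrow> l * z = z * l"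
    using sa_invertible_square_log[OF x y] by blast
  define c where "c = exp ((1/2) *\<^sub>R l)"
  \<comment> \<open>A square root of \<open>c\<close> commuting with \<open>f\<close>, which makes
    \<open>f * c * f\<close> the square of the self-adjoint \<open>e * f\<close>.\<close>
  define e where "e = exp ((1/4) *\<^sub>R l)"
  define f where "f = c - x"
  have c: "sa c" "c * c = x * x" unfolding c_def exp_half_mult_self using l by auto
  have e: "sa e" "e * e = c" unfolding e_def c_def exp_scaleR_add using l by auto
  have f: "sa f" using c x by (auto simp: f_def)
  have lx: "l * x = x * l" by (rule l(3)) (simp add: mult.assoc)
  have cx: "c * x = x * c" unfolding c_def by (intro exp_commutes) (simp add: lx)
  have ex: "e * x = x * e" unfolding e_def by (intro exp_commutes) (simp add: lx)
  have ec: "e * c = c * e" unfolding e(2)[symmetric] by (simp add: mult.assoc)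
  have ef: "e * f = f * e" using ex ec by (simp add: f_def algebra_simps)
  have "(x + c) * f = 0" using cx c by (simp add: f_def algebra_simps)
  then have xf: "x * f = - (c * f)" by (simp add: distrib_right eq_neg_iff_add_eq_0)
  have "st (b * f) * (b * f) = f * (x * f)"
    using f by (simp add: st_mult sa_st b mult.assoc)
  also have "\<dots> = - (f * c * f)" by (simp add: xf mult.assoc)
  also have "f * c * f = (f * e) * (e * f)"
    by (simp only: e(2)[symmetric] mult.assoc)
  also have "\<dots> = (e * f) * (e * f)"
    by (simp only: ef)
  finally have "T (st (b * f) * (b * f)) = - T ((e * f) * (e * f))" by (simp add: T_minus)
  moreover have sef: "sa (e * f)" by (rule sa_mult_commuting[OF e(1) f ef])
  ultimately have "T ((e * f) * (e * f)) = 0"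
    using T_st_mult_nonneg[of "b * f"] T_sa_square_nonneg[OF sef] by simp
  then have "e * f = 0" using sef T_sa_square_eq_0 by blast
  then have "exp (- ((1/4) *\<^sub>R l)) * e * f = 0" by (simp add: mult.assoc)
  then have "f = 0" by (simp add: e_def)
  then have "exp ((1/2) *\<^sub>R l) = x" by (simp add: f_def c_def)
  then show ?thesis using l(1) by blast
qed

end

section \<open>Trace inequalities\<close>

lemma nonneg_derivative_le:
  fixes g :: "real \<Rightarrow> real"
  assumes "\<And>s. (g has_real_derivative g' s) (at s)" "\<And>s. 0 \<le> s \<Longrightarrow> 0 \<le> g' s" "0 \<le> a" "a \<le> b"
  shows "g a \<le> g b"
proof (rule DERIV_nonneg_imp_nondecreasing[OF assms(4)])
  fix x assume "a \<le> x"
  then show "\<exists>y. (g has_real_derivative y) (at x) \<and> 0 \<le> y"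
    using assms by (intro exI[of _ "g' x"]) auto
qed

lemma convex_above_tangent:
  fixes f :: "real \<Rightarrow> real"
  assumes "\<And>t. (f has_real_derivative f1 t) (at t)" "\<And>t. (f1 has_real_derivative f2 t) (at t)"
    "\<And>t. 0 \<le> f2 t"
  shows "f 0 + f1 0 \<le> f 1"
proof -
  have "f1 0 \<le> f1 s" if "0 \<le> s" for s
    using nonneg_derivative_le[of f1 f2 0 s] assms that by auto
  moreover have "((\<lambda>s. f s - f1 0 * s) has_real_derivative f1 s - f1 0) (at s)" for s
    using assms(1) by (auto intro!: derivative_eq_intros)
  ultimately have "f 0 - f1 0 * 0 \<le> f 1 - f1 0 * 1"
    by (intro nonneg_derivative_le[of "\<lambda>s. f s - f1 0 * s" "\<lambda>s. f1 s - f1 0"]) auto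
  then show ?thesis by simp
qed

text \<open>For \<open>f t = 2 cosh (t d)\<close> this is the scalar inequality behind the comparison of the
  two relative entropies; its power series version is \<open>9\<^sup>k \<ge> 1 + 8 k\<close>.\<close>

lemma even_derivatives_nonneg_gap:
  fixes f :: "nat \<Rightarrow> real \<Rightarrow> real"
  assumes der: "\<And>k t. (f k has_real_derivative f (Suc k) t) (at t)"
    and odd: "f 1 0 = 0" "f 3 0 = 0" "f 5 0 = 0"
    and even: "\<And>t. 0 \<le> f 6 t" "0 \<le> f 4 0" "0 \<le> f 2 0"
  shows "f 1 (1/2) + f 4 0 / 192 \<le> (f 0 (3/2) - f 0 (1/2)) / 2"
proof -
  define m where "m = f 4 0"
  have der': "(f 0 has_real_derivative f 1 t) (at t)" "(f 1 has_real_derivative f 2 t) (at t)"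
    "(f 2 has_real_derivative f 3 t) (at t)" "(f 3 has_real_derivative f 4 t) (at t)"
    "(f 4 has_real_derivative f 5 t) (at t)" "(f 5 has_real_derivative f 6 t) (at t)" for t
    using der[of 0 t] der[of 1 t] der[of 2 t] der[of 3 t] der[of 4 t] der[of 5 t]
    by (simp_all add: eval_nat_numeral)
  have f5: "0 \<le> f 5 t" if "0 \<le> t" for t
    using nonneg_derivative_le[OF der'(6) even(1), of 0 t] that odd by simp
  have f4: "m \<le> f 4 t" if "0 \<le> t" for t
    using nonneg_derivative_le[OF der'(5) f5, of 0 t] that by (simp add: m_def)
  have m: "0 \<le> m" using even by (simp add: m_def)
  have f3: "m * t \<le> f 3 t" if "0 \<le> t" for t
  proof -
    have "((\<lambda>t. f 3 t - m * t) has_real_derivative f 4 t - m) (at t)" for t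
      by (auto intro!: derivative_eq_intros der')
    from nonneg_derivative_le[OF this, of 0 t] show ?thesis using that odd f4 by simp
  qed
  have f3_0: "0 \<le> f 3 t" if "0 \<le> t" for t
    using f3[OF that] m that by (meson mult_nonneg_nonneg order_trans)
  \<comment> \<open>\<open>f 2\<close> increases on the nonnegative axis, so \<open>f 1\<close>
    rises on [s, 3s] at least with slope \<open>f 2 s\<close>.\<close>
  have secant: "2 * s * f 2 s \<le> f 1 (3 * s) - f 1 s" if "0 \<le> s" for s
  proof -
    have "((\<lambda>t. f 1 (s + t) - t * f 2 s) has_real_derivative f 2 (s + t) - f 2 s) (at t)" for t
      by (rule derivative_eq_intros DERIV_chain2[OF der'(2)] refl | simp)+
    moreover have "f 2 s \<le> f 2 (s + t)" if "0 \<le> t" for t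
      using nonneg_derivative_le[OF der'(3) f3_0, of s "s + t"] that \<open>0 \<le> s\<close> by simp
    ultimately have "f 1 (s + 0) - 0 * f 2 s \<le> f 1 (s + 2 * s) - (2 * s) * f 2 s"
      using that by (intro nonneg_derivative_le[of "\<lambda>t. f 1 (s + t) - t * f 2 s" "\<lambda>t. f 2 (s + t) - f 2 s"]) auto
    then show ?thesis by simp
  qed
  have chi: "m * s ^ 3 / 3 \<le> s * f 2 s - f 1 s" if "0 \<le> s" for s
  proof -
    have "((\<lambda>s. s * f 2 s - f 1 s - m * s ^ 3 / 3) has_real_derivative s * f 3 s - m * s\<^sup>2) (at s)" for s
      by (auto intro!: derivative_eq_intros der' simp: power2_eq_square simp del: One_nat_def)
    moreover have "0 \<le> s * f 3 s - m * s\<^sup>2" if "0 \<le> s" for s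
      using mult_left_mono[OF f3[OF that] that] by (simp add: power2_eq_square algebra_simps)
    ultimately show ?thesis
      using nonneg_derivative_le[of "\<lambda>s. s * f 2 s - f 1 s - m * s ^ 3 / 3" "\<lambda>s. s * f 3 s - m * s\<^sup>2" 0 s]
        that odd by simp
  qed
  \<comment> \<open>By \<open>secant\<close> its derivative is at least
    \<open>s * f 2 s - f 1 s - m * s ^ 3 / 3\<close>, nonnegative by \<open>chi\<close>. At
    \<open>s = 1/2\<close> the last term is m / (16 * 12) = m / 192.\<close>
  let ?g = "\<lambda>s. (f 0 (3 * s) - f 0 s) / 2 - 2 * s * f 1 s - m * s ^ 4 / 12"
  let ?g' = "\<lambda>s. (f 1 (3 * s) * 3 - f 1 s) / 2 - 2 * f 1 s - 2 * s * f 2 s - m * s ^ 3 / 3"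
  have "((\<lambda>s. f 0 (3 * s)) has_real_derivative f 1 (3 * s) * 3) (at s)" for s
    by (rule DERIV_chain2[OF der'(1)]) (auto intro!: derivative_eq_intros)
  then have "(?g has_real_derivative ?g' s) (at s)" for s
    by (auto intro!: derivative_eq_intros der' simp del: One_nat_def simp: field_simps)
  moreover have "0 \<le> ?g' s" if "0 \<le> s" for s
    using secant[OF that] chi[OF that] by (simp add: field_simps)
  ultimately have "?g 0 \<le> ?g (1/2)" by (intro nonneg_derivative_le[of ?g ?g']) auto
  then show ?thesis by (simp add: m_def power_divide field_simps)
qed

section \<open>Two-sided exponential flows and convexity under the trace\<close>

definition flow :: "'a::{real_normed_algebra_1,banach} \<Rightarrow> 'a \<Rightarrow> 'a \<Rightarrow> real \<Rightarrow> 'a" where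
  "flow X Y z t = exp (t *\<^sub>R X) * z * exp ((- t) *\<^sub>R Y)"

text \<open>The generator of \<open>flow X Y\<close>. Different left and right factors allow
  noncommuting \<open>X\<close> and \<open>Y\<close> to be compared; for \<open>X = Y\<close> it is
  the commutator.\<close>

definition twist :: "'a::{real_normed_algebra_1,banach} \<Rightarrow> 'a \<Rightarrow> 'a \<Rightarrow> 'a" where
  "twist X Y z = X * z - z * Y"

lemma flow_has_vector_derivative:
  "(flow X Y z has_vector_derivative flow X Y (twist X Y z) t) (at t)"
proof -
  have "((\<lambda>t. - t) has_vector_derivative -1) (at t)"
    unfolding has_real_derivative_iff_has_vector_derivative[symmetric]
    by (auto intro!: derivative_eq_intros)
  from vector_diff_chain_at[OF this exp_scaleR_has_vector_derivative_left]
  have e: "((\<lambda>t. exp ((- t) *\<^sub>R Y)) has_vector_derivative (-1) *\<^sub>R (Y * exp ((- t) *\<^sub>R Y))) (at t)"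
    by (simp only: o_def)
  have "((\<lambda>t. exp (t *\<^sub>R X) * z) has_vector_derivative exp (t *\<^sub>R X) * X * z) (at t)"
    by (rule bounded_linear.has_vector_derivative[OF bounded_linear_mult_left])
       (rule exp_scaleR_has_vector_derivative_right)
  from has_vector_derivative_mult[OF this e] show ?thesis
    unfolding flow_def[abs_def] by (rule has_vector_derivative_eq_rhs) (simp add: twist_def algebra_simps)
qed

context traced_cstar_algebra
begin

text \<open>For self-adjoint \<open>h\<close> the element \<open>2 * norm h - h\<close> is an
  exponential, hence positive; the factor 2 gives the strict inequality needed in
  \<open>sa_log_ball\<close>. In general \<open>x + st x\<close> has twice the value of
  \<open>T\<close> at \<open>x\<close>.\<close>

lemma bounded_linear_T: "bounded_linear T"
proof (rule bounded_linear_intro[of _ "2 * T 1"])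
  fix x
  have sa_bound: "T h \<le> norm h * (2 * T 1)" if "sa h" for h
  proof (cases "h = 0")
    case False
    then have "norm ((2 * norm h) *\<^sub>R 1 - ((2 * norm h) *\<^sub>R 1 - h)) < 2 * norm h" by simp
    then obtain l where l: "sa l" "exp l = (2 * norm h) *\<^sub>R 1 - h"
      using sa_log_ball \<open>sa h\<close> by (metis sa_1 sa_diff sa_scaleR)
    have "0 \<le> T (exp l)" unfolding T_def using l by (intro tau_cpos cpos_exp)
    then show ?thesis unfolding l by (simp add: T_diff T_scaleR algebra_simps)
  qed simp
  have "sa (x + st x)" by (simp add: sa_def st_add add.commute)
  then have "\<bar>T (x + st x)\<bar> \<le> norm (x + st x) * (2 * T 1)"
    using sa_bound[of "x + st x"] sa_bound[OF sa_minus, of "x + st x"]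
    unfolding norm_minus_cancel T_minus by linarith
  also have "\<dots> \<le> (2 * norm x) * (2 * T 1)"
    using norm_triangle_ineq[of x "st x"] T_sa_square_nonneg[of 1] by (intro mult_right_mono) auto
  finally show "norm (T x) \<le> norm x * (2 * T 1)" by (simp add: T_add T_st)
qed (simp_all add: T_add T_scaleR)

lemmas T_has_derivative = bounded_linear.has_vector_derivative[OF bounded_linear_T]

lemma T_flow_has_derivative:
  "((\<lambda>t. T (c * flow X Y z t)) has_real_derivative T (c * flow X Y (twist X Y z) t)) (at t)"
  unfolding has_real_derivative_iff_has_vector_derivative
  by (intro T_has_derivative bounded_linear.has_vector_derivative[OF bounded_linear_mult_right]
      flow_has_vector_derivative)

text \<open>In the pairing \<open>T (st w * z)\<close> left and right multiplication by self-adjoint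
  elements are symmetric, and the generator commutes with its flow. A second derivative can thus be
  split evenly between both arguments.\<close>

lemma T_flow_twist:
  assumes "sa X" "sa Y"
  shows "T (st w * flow X Y (twist X Y z) t) = T (st (twist X Y w) * flow X Y z t)"
proof -
  let ?e = "exp (t *\<^sub>R X)" and ?f = "exp ((- t) *\<^sub>R Y)"
  have "st w * (?e * (X * z) * ?f) = st w * X * (?e * z * ?f)"
    by (simp only: mult.assoc exp_times_scaleR_commute flip: mult.assoc[of ?e X])
  moreover have "T (st w * (?e * (z * Y) * ?f)) = T (Y * st w * (?e * z * ?f))"
  proof -
    have "st w * (?e * (z * Y) * ?f) = (st w * ?e * z * ?f) * Y"
      using exp_times_scaleR_commute[of "- t" Y] by (simp only: mult.assoc)
    then show ?thesis by (metis T_commute mult.assoc)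
  qed
  ultimately show ?thesis
    using assms by (simp add: flow_def twist_def st_diff st_mult sa_st T_diff algebra_simps)
qed

text \<open>Half of the flow is moved to the left argument.\<close>

lemma T_flow_eq_square:
  assumes "sa X" "sa Y"
  shows "T (st w * flow X Y w t) = T (st (flow X Y w (t/2)) * flow X Y w (t/2))"
proof -
  have "T (st (flow X Y w (t/2)) * flow X Y w (t/2)) =
      T (exp ((- (t/2)) *\<^sub>R Y) * (st w * exp ((t/2) *\<^sub>R X) * (exp ((t/2) *\<^sub>R X) * w * exp ((- (t/2)) *\<^sub>R Y))))"
    using assms by (simp add: flow_def st_mult st_exp st_scaleR st_minus sa_st mult.assoc)
  also have "\<dots> = T (st w * ((exp ((t/2) *\<^sub>R X) * exp ((t/2) *\<^sub>R X)) * w *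
      (exp ((- (t/2)) *\<^sub>R Y) * exp ((- (t/2)) *\<^sub>R Y))))"
    by (subst T_commute) (simp only: mult.assoc)
  also have "\<dots> = T (st w * flow X Y w t)"
    unfolding exp_scaleR_add flow_def by simp
  finally show ?thesis by simp
qed

lemma T_flow_nonneg: "sa X \<Longrightarrow> sa Y \<Longrightarrow> 0 \<le> T (st w * flow X Y w t)"
  by (simp only: T_flow_eq_square T_st_mult_nonneg)

lemma T_flow_eq_0:
  assumes "sa X" "sa Y" "T (st w * flow X Y w t) = 0"
  shows "w = 0"
proof -
  have "flow X Y w (t/2) = 0"
    using assms T_st_mult_eq_0 by (simp add: T_flow_eq_square)
  then have "exp ((- (t/2)) *\<^sub>R X) * flow X Y w (t/2) * exp ((t/2) *\<^sub>R Y) = 0" by simp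
  also have "exp ((- (t/2)) *\<^sub>R X) * flow X Y w (t/2) * exp ((t/2) *\<^sub>R Y) =
    (exp ((- (t/2)) *\<^sub>R X) * exp ((t/2) *\<^sub>R X)) * w * (exp ((- (t/2)) *\<^sub>R Y) * exp ((t/2) *\<^sub>R Y))"
    by (simp only: flow_def mult.assoc)
  finally show ?thesis unfolding exp_scaleR_add by simp
qed

text \<open>The second derivative is a pairing as in \<open>T_flow_nonneg\<close> at
  \<open>twist X Y w\<close>, so the graph lies above its tangent at 0. Klein's inequality and the
  entropy bounds are instances.\<close>

lemma T_flow_above_tangent:
  assumes "sa X" "sa Y"
  shows "T (st w * w) + T (st w * twist X Y w) \<le> T (st w * (exp X * w * exp (- Y)))"
proof -
  have "0 \<le> T (st w * flow X Y (twist X Y (twist X Y w)) t)" for t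
    using T_flow_nonneg[OF assms, of "twist X Y w" t] by (simp only: T_flow_twist[OF assms, of w])
  from convex_above_tangent[OF T_flow_has_derivative T_flow_has_derivative this]
  show ?thesis by (simp add: flow_def)
qed

text \<open>The convex function \<open>f t = T (exp ((1 + t) X) * exp (- t Y))\<close> takes equal
  values at -1, 0 and 1. Rolle's theorem, used three times, gives a zero of its second derivative,
  which forces \<open>X * w = w * Y\<close> for the invertible
  \<open>w = exp (X / 2)\<close>.\<close>

lemma exp_inj_sa:
  assumes "sa X" "sa Y" "exp X = exp Y"
  shows "X = Y"
proof -
  define w where "w = exp ((1/2) *\<^sub>R X)"
  have w: "st w = w" "w * w = exp X" using assms by (simp_all add: w_def exp_half_mult_self sa_st sa_exp sa_scaleR)
  have wX: "w * exp (t *\<^sub>R X) * w = exp ((1 + t) *\<^sub>R X)" for t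
    unfolding w_def exp_scaleR_add by simp
  define f where "f = (\<lambda>t. T (st w * flow X Y w t))"
  define f1 where "f1 = (\<lambda>t. T (st w * flow X Y (twist X Y w) t))"
  define f2 where "f2 = (\<lambda>t. T (st (twist X Y w) * flow X Y (twist X Y w) t))"
  have d: "(f has_real_derivative f1 t) (at t)" "(f1 has_real_derivative f2 t) (at t)" for t
    unfolding f_def f1_def f2_def using T_flow_has_derivative T_flow_twist[OF assms(1,2), symmetric] by simp_all
  have f: "f t = T (exp ((1 + t) *\<^sub>R X) * exp ((- t) *\<^sub>R Y))" for t
    unfolding f_def flow_def w(1) wX[symmetric] by (simp only: mult.assoc)
  have eX: "exp (2 *\<^sub>R X) = exp X * exp X" using exp_half_mult_self[of "2 *\<^sub>R X"] by simp
  have "f (-1) = T (exp X)" "f 0 = T (exp X)" "f 1 = T (exp X)"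
    unfolding f using assms(3) by (simp_all add: eX mult.assoc)
  note vals = this
  have cont: "continuous_on S f" "continuous_on S f1" for S
    using d DERIV_isCont continuous_at_imp_continuous_on by blast+
  obtain a where a: "-1 < a" "a < 0" "(f has_real_derivative 0) (at a)"
    using Rolle[of "-1" 0 f] vals cont d(1) real_differentiable_def by (metis neg_less_0_iff_less zero_less_one)
  obtain b where b: "0 < b" "b < 1" "(f has_real_derivative 0) (at b)"
    using Rolle[of 0 1 f] vals cont d(1) real_differentiable_def by (metis zero_less_one)
  have "f1 a = 0" "f1 b = 0" using a b d(1) DERIV_unique by blast+
  then obtain c where "(f1 has_real_derivative 0) (at c)"
    using Rolle[of a b f1] a b cont d(2) real_differentiable_def by (metis less_trans)
  then have "f2 c = 0" using d(2) DERIV_unique by blast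
  then have "twist X Y w = 0" unfolding f2_def using T_flow_eq_0 assms by blast
  then have "X * w = w * Y" by (simp add: twist_def)
  moreover have "X * w = w * X" unfolding w_def by (simp add: exp_times_scaleR_commute)
  ultimately have "exp (- ((1/2) *\<^sub>R X)) * (w * X) = exp (- ((1/2) *\<^sub>R X)) * (w * Y)" by simp
  then show ?thesis by (simp add: w_def flip: mult.assoc)
qed

subsection \<open>Positive invertible elements\<close>

abbreviation lg :: "'a \<Rightarrow> 'a" where "lg \<equiv> clog st"

definition posinv :: "'a \<Rightarrow> bool" where "posinv a \<longleftrightarrow> cpos st a \<and> cinvertible a"

lemma posinv_exp [simp, intro]: "sa l \<Longrightarrow> posinv (exp l)"
  by (simp add: posinv_def cpos_exp)

lemma clog_exp [simp]: "sa l \<Longrightarrow> lg (exp l) = l"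
  unfolding clog_def by (rule the_equality) (auto simp: sa_def[symmetric] intro: exp_inj_sa)

lemma posinvE:
  assumes "posinv a"
  obtains l where "sa l" "a = exp l" "lg a = l"
  using positive_invertible_log[of a] assms clog_exp unfolding posinv_def by metis

lemma sa_lg [simp, intro]: "posinv a \<Longrightarrow> sa (lg a)"
  and exp_lg [simp]: "posinv a \<Longrightarrow> exp (lg a) = a"
  and posinv_sa [intro]: "posinv a \<Longrightarrow> sa a"
  by (auto elim!: posinvE)

lemma cinv_eqI: "x * y = 1 \<Longrightarrow> y * x = 1 \<Longrightarrow> cinv x = y"
  unfolding cinv_def by (rule the_equality) (auto, metis mult.assoc mult.left_neutral mult.right_neutral)

lemma cinv_exp [simp]: "cinv (exp x) = exp (- x)"
  by (rule cinv_eqI) simp_all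

text \<open>Any positive root is invertible, hence an exponential, and \<open>exp_inj_sa\<close>
  determines its exponent.\<close>

lemma csqrt_exp [simp]:
  assumes "sa l"
  shows "csqrt st (exp l) = exp ((1/2) *\<^sub>R l)"
  unfolding csqrt_def
proof (rule the_equality)
  show "cpos st (exp ((1/2) *\<^sub>R l)) \<and> exp ((1/2) *\<^sub>R l) * exp ((1/2) *\<^sub>R l) = exp l"
    using assms by (simp only: exp_half_mult_self cpos_exp sa_scaleR simp_thms)
next
  fix b assume b: "cpos st b \<and> b * b = exp l"
  then have "b * (b * exp (- l)) = 1" "(exp (- l) * b) * b = 1"
    by (simp_all add: mult.assoc[symmetric]) (simp add: mult.assoc)
  then have "cinvertible b"
    unfolding cinvertible_def by (metis mult.assoc mult.left_neutral mult.right_neutral)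
  then obtain k where k: "sa k" "b = exp k" using b positive_invertible_log by metis
  then have "exp (2 *\<^sub>R k) = exp l" using b exp_half_mult_self[of "2 *\<^sub>R k"] by simp
  then have "2 *\<^sub>R k = l" using exp_inj_sa k assms by blast
  then show "b = exp ((1/2) *\<^sub>R l)" using k by auto
qed

lemma posinv_congruence:
  assumes "posinv a" "c * d = 1" "d * c = 1" "sa c"
  shows "posinv (c * a * c)"
  unfolding posinv_def
proof
  obtain l where l: "sa l" "a = exp l" using assms(1) by (rule posinvE)
  have "c * a * c = st (exp ((1/2) *\<^sub>R l) * c) * (exp ((1/2) *\<^sub>R l) * c)"
    using l assms by (simp add: st_mult sa_st sa_exp sa_scaleR mult.assoc)
      (simp add: exp_half_mult_self flip: mult.assoc)
  then show "cpos st (c * a * c)" by simp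
  have "(c * a * c) * (d * exp (- l) * d) = 1" "(d * exp (- l) * d) * (c * a * c) = 1"
    using assms(2,3) l(2) by (metis exp_mult_exp_minus mult.assoc mult.left_neutral)+
  then show "cinvertible (c * a * c)" unfolding cinvertible_def by blast
qed

lemma posinv_scaleR [intro]:
  assumes "posinv a" "0 < r"
  shows "posinv (r *\<^sub>R a)" and "lg (r *\<^sub>R a) = lg a + ln r *\<^sub>R 1"
proof -
  obtain l where l: "sa l" "a = exp l" using assms by (elim posinvE)
  have e: "r *\<^sub>R a = exp (l + ln r *\<^sub>R 1)" unfolding exp_add_scalar l using assms by simp
  have s: "sa (l + ln r *\<^sub>R 1)" using l by auto
  show "posinv (r *\<^sub>R a)" unfolding e using s by blast
  show "lg (r *\<^sub>R a) = lg a + ln r *\<^sub>R 1" unfolding e using s l by simp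
qed

lemma posinv_1 [simp, intro]: "posinv 1" using posinv_exp[of 0] by simp

text \<open>With \<open>a = x * x\<close>, the summand 1 moves the closed ball of
  \<open>norm_scalar_minus_square\<close> off 0.\<close>

lemma posinv_one_plus:
  assumes "posinv a"
  shows "posinv (1 + a)"
proof -
  obtain l where l: "sa l" "a = exp l" using assms by (rule posinvE)
  define x where "x = exp ((1/2) *\<^sub>R l)"
  have x: "sa x" "x * x = a" unfolding x_def exp_half_mult_self using l by auto
  define R where "R = norm x + 1"
  have "norm (R\<^sup>2 *\<^sub>R 1 - x * x) \<le> R\<^sup>2"
    using x by (intro norm_scalar_minus_square) (simp_all add: R_def)
  then have "norm ((R\<^sup>2 + 1) *\<^sub>R 1 - (1 + a)) < R\<^sup>2 + 1"
    by (simp add: x algebra_simps)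
  then obtain k where "sa k" "exp k = 1 + a"
    using sa_log_ball x by (metis sa_1 sa_add sa_mult_self)
  then show ?thesis by (metis posinv_exp)
qed

text \<open>\<open>cpos\<close> asks for a single factor \<open>st b * b\<close>, so sums need an
  argument: with \<open>c\<close> the root of \<open>a\<close> and \<open>d\<close> its inverse,
  \<open>a + b = c * (1 + d * b * d) * c\<close>.\<close>

lemma posinv_add [intro]:
  assumes "posinv a" "posinv b"
  shows "posinv (a + b)"
proof -
  obtain l where l: "sa l" "a = exp l" using assms by (elim posinvE)
  define c d where "c = exp ((1/2) *\<^sub>R l)" and "d = exp (- ((1/2) *\<^sub>R l))"
  have cd: "c * d = 1" "d * c = 1" "sa c" "sa d" "c * c = a"
    unfolding c_def d_def exp_half_mult_self using l by auto
  have "posinv (c * (1 + d * b * d) * c)"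
    using assms cd by (intro posinv_congruence[of _ c d] posinv_one_plus posinv_congruence[of b d c])
  also have "c * (1 + d * b * d) * c = c * c + (c * d) * b * (d * c)"
    by (simp only: distrib_left distrib_right mult.assoc mult.left_neutral)
  finally show ?thesis by (simp add: cd)
qed

lemma dens_iff: "a \<in> dens st \<tau> \<longleftrightarrow> posinv a \<and> T a = 1"
  using tau_sa[of a] posinv_sa[of a] by (auto simp: dens_def posinv_def T_def)


subsection \<open>Bounds for the two relative entropies\<close>

definition umegaki :: "'a \<Rightarrow> 'a \<Rightarrow> real" where
  "umegaki A B = T (A * (lg A - lg B))"

definition bel_stas :: "'a \<Rightarrow> 'a \<Rightarrow> real" where
  "bel_stas A B = T (A * lg (csqrt st A * cinv B * csqrt st A))"

lemma bel_stas_exp: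
  assumes "sa X" "sa Y"
  obtains q where "sa q" "exp q = exp ((1/2) *\<^sub>R X) * exp (- Y) * exp ((1/2) *\<^sub>R X)"
    "bel_stas (exp X) (exp Y) = T (exp X * q)" "S_BS st \<tau> (exp X) (exp Y) = \<tau> (exp X * q)"
proof -
  have "posinv (exp ((1/2) *\<^sub>R X) * exp (- Y) * exp ((1/2) *\<^sub>R X))"
    using assms by (intro posinv_congruence[of _ _ "exp (- ((1/2) *\<^sub>R X))"]) auto
  then obtain q where q: "sa q" "exp ((1/2) *\<^sub>R X) * exp (- Y) * exp ((1/2) *\<^sub>R X) = exp q"
    by (rule posinvE)
  then show ?thesis using assms that[of q] by (simp add: bel_stas_def S_BS_def)
qed

lemma S_U_eq: "posinv A \<Longrightarrow> posinv B \<Longrightarrow> S_U st \<tau> A B = complex_of_real (umegaki A B)"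
  unfolding S_U_def umegaki_def by (intro tau_sa_mult sa_diff) auto

lemma S_BS_eq: "posinv A \<Longrightarrow> posinv B \<Longrightarrow> S_BS st \<tau> A B = complex_of_real (bel_stas A B)"
  by (metis bel_stas_exp posinvE sa_exp tau_sa_mult)

lemma exp_half_sandwich:
  "exp ((1/2) *\<^sub>R X) * exp X * exp ((1/2) *\<^sub>R X) = exp X * exp (X::'a)"
  using exp_scaleR_add[of "1/2" X 1] exp_scaleR_add[of "3/2" X "1/2"] exp_scaleR_add[of 1 X 1] by simp

text \<open>Both are the tangent inequality at \<open>w = exp (X / 2)\<close>, for the exponents
  \<open>X, Y\<close> and for \<open>- X, - Y\<close>; the second is Klein's inequality.\<close>

lemma umegaki_exp_upper:
  assumes "sa X" "sa Y"
  shows "T (exp X * (X - Y)) \<le> T (exp X * exp X * exp (- Y)) - T (exp X)"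
    and umegaki_exp_lower: "T (exp X) - T (exp Y) \<le> T (exp X * (X - Y))"
proof -
  define w where "w = exp ((1/2) *\<^sub>R X)"
  have w: "st w = w" "w * w = exp X" "w * X = X * w" "w * exp X * w = exp X * exp X"
    "w * exp (- X) * w = 1"
    using assms exp_scaleR_add[of "1/2" X "-1"] exp_scaleR_add[of "-1/2" X "1/2"]
    by (simp_all add: w_def exp_half_mult_self exp_half_sandwich sa_st sa_exp sa_scaleR exp_times_scaleR_commute)
  have tw: "w * twist X Y w = exp X * (X - Y)"
  proof -
    have "w * twist X Y w = w * w * X - w * w * Y"
      by (simp only: twist_def right_diff_distrib mult.assoc w(3))
    then show ?thesis by (simp add: w(2) right_diff_distrib)
  qed
  show "T (exp X * (X - Y)) \<le> T (exp X * exp X * exp (- Y)) - T (exp X)"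
    using T_flow_above_tangent[OF assms, of w] unfolding w(1,2) tw
    by (simp add: mult.assoc[symmetric] w(4))
  have "twist (- X) (- Y) w = - twist X Y w" by (simp add: twist_def)
  then show "T (exp X) - T (exp Y) \<le> T (exp X * (X - Y))"
    using T_flow_above_tangent[of "- X" "- Y" w] assms unfolding w(1,2)
    by (simp add: mult.assoc[symmetric] w(5) tw T_minus sa_minus)
qed

text \<open>The first two use the tangent inequality at \<open>exp (X / 2)\<close> with exponents
  \<open>- q, 0\<close> and \<open>q, 0\<close>. The last two are the Umegaki bounds for the pair
  \<open>X, q\<close>; they are sharp at \<open>Y = 0\<close> and are needed for differentiating
  there.\<close>

lemma bel_stas_exp_bounds:
  assumes "sa X" "sa Y"
  shows "T (exp X) - T (exp Y) \<le> bel_stas (exp X) (exp Y)"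
    and "bel_stas (exp X) (exp Y) \<le> T (exp X * exp X * exp (- Y)) - T (exp X)"
    and "T (exp X) - T (exp X * exp Y) \<le> bel_stas (exp X) (exp Y) - T (exp X * X)"
    and "bel_stas (exp X) (exp Y) - T (exp X * X) \<le> T (exp X * exp (- Y)) - T (exp X)"
proof -
  obtain q where q: "sa q" "exp q = exp ((1/2) *\<^sub>R X) * exp (- Y) * exp ((1/2) *\<^sub>R X)"
    and bel_stas: "bel_stas (exp X) (exp Y) = T (exp X * q)"
    using bel_stas_exp[OF assms] by metis
  define w v where "w = exp ((1/2) *\<^sub>R X)" and "v = exp (- ((1/2) *\<^sub>R X))"
  have w: "st w = w" "w * w = exp X" "w * exp X * w = exp X * exp X" "w * v = 1" "v * w = 1"
    using assms by (simp_all add: w_def v_def exp_half_mult_self exp_half_sandwich sa_st sa_exp sa_scaleR)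
  have q1: "exp q = w * exp (- Y) * w" using q by (simp add: w_def)
  have q2: "exp (- q) = v * exp Y * v"
  proof -
    have "(v * exp Y * v) * exp q = v * exp Y * (v * w) * exp (- Y) * w"
      by (simp only: q1 mult.assoc)
    also have "\<dots> = v * (exp Y * exp (- Y)) * w" by (simp only: w mult.assoc mult.left_neutral)
    finally have "(v * exp Y * v) * exp q * exp (- q) = exp (- q)" by (simp add: w)
    then show ?thesis by (simp add: mult.assoc)
  qed
  have exv: "exp X * v = w" "v * exp X = w" using w by (metis mult.assoc mult.left_neutral mult.right_neutral)+
  have T1: "T (exp X * exp q) = T (exp X * exp X * exp (- Y))"
    unfolding q1 w(3)[symmetric] by (metis T_commute mult.assoc)
  have T2: "T (exp X * exp (- q)) = T (exp Y)"
    unfolding q2 by (metis T_commute exv w(4,5) mult.assoc mult.right_neutral)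
  have T3: "T (exp q) = T (exp X * exp (- Y))"
    unfolding q1 w(2)[symmetric] by (metis T_commute mult.assoc)
  have T4: "T (exp X * exp X * exp (- q)) = T (exp X * exp Y)"
  proof -
    have "T (exp X * exp X * exp (- q)) = T ((v * exp X) * (exp X * v) * exp Y)"
      unfolding q2 by (metis T_commute mult.assoc)
    then show ?thesis by (simp add: exv w)
  qed
  have T5: "T (w * (q * w)) = T (exp X * q)" "T (w * (exp q * w)) = T (exp X * exp q)"
    "T (w * (exp (- q) * w)) = T (exp X * exp (- q))"
    unfolding w(2)[symmetric] by (metis T_commute mult.assoc)+
  show "bel_stas (exp X) (exp Y) \<le> T (exp X * exp X * exp (- Y)) - T (exp X)"
    using T_flow_above_tangent[OF q(1) sa_0, of w] unfolding w(1,2)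
    by (simp add: twist_def T5 bel_stas T1)
  show "T (exp X) - T (exp Y) \<le> bel_stas (exp X) (exp Y)"
    using T_flow_above_tangent[OF sa_minus[OF q(1)] sa_0, of w] unfolding w(1,2)
    by (simp add: twist_def T5 bel_stas T2 T_minus)
  show "T (exp X) - T (exp X * exp Y) \<le> bel_stas (exp X) (exp Y) - T (exp X * X)"
    using umegaki_exp_upper[OF assms(1) q(1)] by (simp add: T4 bel_stas right_diff_distrib T_diff)
  show "bel_stas (exp X) (exp Y) - T (exp X * X) \<le> T (exp X * exp (- Y)) - T (exp X)"
    using umegaki_exp_lower[OF assms(1) q(1)] by (simp add: T3 bel_stas right_diff_distrib T_diff)
qed

lemma umegaki_bounds:
  assumes "posinv A" "posinv B"
  shows "T A - T B \<le> umegaki A B" "umegaki A B \<le> T (A * A * cinv B) - T A"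
  using umegaki_exp_lower[of "lg A" "lg B"] umegaki_exp_upper[of "lg A" "lg B"] assms cinv_exp[of "lg B"]
  by (simp_all add: umegaki_def)

lemma bel_stas_bounds:
  assumes "posinv A" "posinv B"
  shows "T A - T B \<le> bel_stas A B" "bel_stas A B \<le> T (A * A * cinv B) - T A"
    "T A - T (A * B) \<le> bel_stas A B - T (A * lg A)" "bel_stas A B - T (A * lg A) \<le> T (A * cinv B) - T A"
  using bel_stas_exp_bounds[of "lg A" "lg B"] assms cinv_exp[of "lg B"]
  by simp_all

lemma umegaki_scaleR_right:
  "posinv A \<Longrightarrow> posinv B \<Longrightarrow> 0 < r \<Longrightarrow> umegaki A (r *\<^sub>R B) = umegaki A B - ln r * T A"
  by (simp add: umegaki_def posinv_scaleR algebra_simps T_diff T_add T_scaleR)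

lemma umegaki_scaleR_left:
  "posinv A \<Longrightarrow> posinv B \<Longrightarrow> 0 < r \<Longrightarrow> umegaki (r *\<^sub>R A) B = r * umegaki A B + r * ln r * T A"
  by (simp add: umegaki_def posinv_scaleR algebra_simps T_diff T_add T_scaleR)

lemma bel_stas_scaleR:
  assumes "posinv A" "posinv B" "0 < r" "0 < s"
  shows "bel_stas (r *\<^sub>R A) (s *\<^sub>R B) = r * bel_stas A B + r * (ln r - ln s) * T A"
proof -
  define X Y where "X = lg A" and "Y = lg B"
  have XY: "sa X" "sa Y" "exp X = A" "exp Y = B" using assms by (auto simp: X_def Y_def)
  obtain q where q: "sa q" "exp q = exp ((1/2) *\<^sub>R X) * exp (- Y) * exp ((1/2) *\<^sub>R X)"
    and bel_stas: "bel_stas (exp X) (exp Y) = T (exp X * q)"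
    using bel_stas_exp[OF XY(1,2)] by metis
  obtain q' where q': "sa q'" "exp q' = exp ((1/2) *\<^sub>R (X + ln r *\<^sub>R 1)) * exp (- (Y + ln s *\<^sub>R 1)) * exp ((1/2) *\<^sub>R (X + ln r *\<^sub>R 1))"
    and bel_stas': "bel_stas (exp (X + ln r *\<^sub>R 1)) (exp (Y + ln s *\<^sub>R 1)) = T (exp (X + ln r *\<^sub>R 1) * q')"
    using bel_stas_exp[of "X + ln r *\<^sub>R 1" "Y + ln s *\<^sub>R 1"] XY by (metis sa_1 sa_add sa_scaleR)
  have e: "(1/2) *\<^sub>R (X + ln r *\<^sub>R 1) = (1/2) *\<^sub>R X + (ln r / 2) *\<^sub>R 1"
    "- (Y + ln s *\<^sub>R 1) = - Y + (- ln s) *\<^sub>R 1"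
    by (simp_all add: algebra_simps)
  have "exp q' = exp (ln r / 2 + - ln s + ln r / 2) *\<^sub>R exp q"
    unfolding q' e exp_add_scalar q by (simp add: mult_exp_exp algebra_simps)
  also have "\<dots> = exp (q + (ln r - ln s) *\<^sub>R 1)"
    by (simp add: exp_add_scalar)
  finally have "q' = q + (ln r - ln s) *\<^sub>R 1"
    using q q' exp_inj_sa by (metis sa_1 sa_add sa_scaleR)
  note q_eq = this
  have e2: "exp (X + ln r *\<^sub>R 1) = r *\<^sub>R A" "exp (Y + ln s *\<^sub>R 1) = s *\<^sub>R B"
    unfolding exp_add_scalar using XY assms by simp_all
  have "bel_stas (r *\<^sub>R A) (s *\<^sub>R B) = T ((r *\<^sub>R A) * (q + (ln r - ln s) *\<^sub>R 1))"
    using bel_stas' unfolding e2 q_eq .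
  then show ?thesis using bel_stas XY by (simp add: algebra_simps T_add T_diff T_scaleR)
qed

text \<open>Writing \<open>d\<close> for \<open>z \<mapsto> X z - z Y\<close>, the right-hand side minus the first term on the left is
  the value at \<open>d\<close> of \<open>cosh (3d/2) - cosh (d/2) - 2 d sinh (d/2)\<close>, of which the correction
  term is a fraction of the \<open>d\<^sup>4\<close> part.\<close>

lemma umegaki_symmetric_gap:
  assumes "sa X" "sa Y"
  defines "z \<equiv> exp ((1/4) *\<^sub>R X) * (X * (X - Y) - (X - Y) * Y) * exp ((1/4) *\<^sub>R Y)"
  shows "T ((exp X - exp Y) * (X - Y)) + T (st z * z) / 96 \<le>
    (T (exp X * exp X * exp (- Y)) + T (exp Y * exp Y * exp (- X)) - T (exp X) - T (exp Y)) / 2"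
proof -
  define D where "D = twist X Y"
  \<comment> \<open>The quarters yield
    \<open>g 0 t = T (exp ((1/2 + t) X) * exp ((1/2 - t) Y))\<close>, whose values at 1/2, -1/2, 3/2
    and -3/2 are the traces in the claim.\<close>
  define w where "w = exp ((1/4) *\<^sub>R X) * exp ((1/4) *\<^sub>R Y)"
  define g where "g = (\<lambda>k t. T (st w * flow X Y ((D ^^ k) w) t))"
  \<comment> \<open>The derivatives of the even function \<open>g 0 t + g 0 (- t)\<close>, so those
    of odd order vanish at 0.\<close>
  define f where "f = (\<lambda>k t. g k t + (-1) ^ k * g k (- t))"
  have gder: "(g k has_real_derivative g (Suc k) t) (at t)" for k t
    unfolding g_def using T_flow_has_derivative[of "st w" X Y "(D ^^ k) w"] by (simp add: D_def)
  have fder: "(f k has_real_derivative f (Suc k) t) (at t)" for k t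
    unfolding f_def
    by (rule DERIV_cong[OF DERIV_add[OF gder DERIV_cmult[OF DERIV_chain2[OF gder DERIV_minus[OF DERIV_ident]]]]]) simp
  have move: "T (st u * flow X Y ((D ^^ k) v) t) = T (st ((D ^^ k) u) * flow X Y v t)" for u v k t
  proof (induction k arbitrary: u v)
    case (Suc k)
    have "T (st u * flow X Y ((D ^^ Suc k) v) t) = T (st (D u) * flow X Y ((D ^^ k) v) t)"
      using T_flow_twist[OF assms(1,2)] by (simp add: D_def)
    then show ?case unfolding Suc.IH by (simp add: funpow_swap1)
  qed simp
  have geven: "g (2 * k) t = T (st ((D ^^ k) w) * flow X Y ((D ^^ k) w) t)" for k t
    unfolding g_def mult_2 funpow_add comp_apply by (rule move)
  have gnn: "0 \<le> g (2 * k) t" for k t unfolding geven using T_flow_nonneg assms by blast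
  have fnn: "0 \<le> f (2 * k) t" for k t unfolding f_def using gnn by simp
  have ineq: "f 1 (1/2) + f 4 0 / 192 \<le> (f 0 (3/2) - f 0 (1/2)) / 2"
  proof (rule even_derivatives_nonneg_gap[of f, OF fder])
    show "f 1 0 = 0" "f 3 0 = 0" "f 5 0 = 0" by (simp_all add: f_def)
    show "0 \<le> f 6 t" "0 \<le> f 4 0" "0 \<le> f 2 0" for t
      using fnn[of 3 t] fnn[of 2 0] fnn[of 1 0] by simp_all
  qed
  have stw: "st w = exp ((1/4) *\<^sub>R Y) * exp ((1/4) *\<^sub>R X)"
    using assms by (simp add: w_def st_mult st_exp st_scaleR sa_st)
  have comm: "T (exp (a *\<^sub>R Y) * x) = T (x * exp (a *\<^sub>R Y))" for a x by (rule T_commute)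
  have xx: "exp (a *\<^sub>R X) * (exp (b *\<^sub>R X) * x) = exp ((a + b) *\<^sub>R X) * x"
    for a b x
    by (simp only: exp_scaleR_add mult.assoc[symmetric])
  have xX: "X * (exp (b *\<^sub>R X) * x) = exp (b *\<^sub>R X) * (X * x)" for b x
    by (simp only: exp_times_scaleR_commute mult.assoc[symmetric])
  have g0: "g 0 t = T (exp ((1/2 + t) *\<^sub>R X) * exp ((1/2 - t) *\<^sub>R Y))" for t
    unfolding g_def stw unfolding w_def flow_def
    by (simp only: funpow_0 mult.assoc comm xx exp_scaleR_add) (simp add: algebra_simps)
  have g1: "g 1 t = T (exp ((1/2 + t) *\<^sub>R X) * (X - Y) * exp ((1/2 - t) *\<^sub>R Y))" for t
  proof -
    have Yr: "exp (b *\<^sub>R Y) * (Y * x) = Y * (exp (b *\<^sub>R Y) * x)" for b x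
      by (simp only: exp_times_scaleR_commute mult.assoc[symmetric])
    have "D w = exp ((1/4) *\<^sub>R X) * (X - Y) * exp ((1/4) *\<^sub>R Y)"
      by (simp only: D_def twist_def w_def mult.assoc left_diff_distrib right_diff_distrib xX exp_times_scaleR_commute)
    then show ?thesis
      unfolding g_def stw flow_def
      by (simp only: One_nat_def funpow.simps comp_apply id_apply mult.assoc comm xx exp_scaleR_add)
        (simp add: algebra_simps)
  qed
  have D2: "(D ^^ 2) w = z"
  proof -
    have "(D ^^ 2) w = X * (X * w) - 2 *\<^sub>R (X * w * Y) + w * Y * Y"
      by (simp add: numeral_2_eq_2 D_def twist_def algebra_simps scaleR_2)
    also have "\<dots> = exp ((1/4) *\<^sub>R X) * (X * X - 2 *\<^sub>R (X * Y) + Y * Y) * exp ((1/4) *\<^sub>R Y)"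
      unfolding w_def
      by (simp add: mult.assoc distrib_left distrib_right left_diff_distrib right_diff_distrib xX exp_times_scaleR_commute)
    finally show ?thesis unfolding z_def by (simp add: algebra_simps scaleR_2)
  qed
  \<comment> \<open>The symmetrisation doubles the term and turns 1/192 into 1/96.\<close>
  have f4: "f 4 0 = 2 * T (st z * z)"
    using geven[of 2 0] by (simp add: f_def D2 flow_def)
  have e2: "exp (2 *\<^sub>R x) = exp x * exp x" for x :: 'a using exp_half_mult_self[of "2 *\<^sub>R x"] by simp
  have f03: "f 0 (3/2) = T (exp X * exp X * exp (- Y)) + T (exp Y * exp Y * exp (- X))"
    unfolding f_def g0 by (simp add: e2 T_commute[of "exp (- X)"])
  have f01: "f 0 (1/2) = T (exp X) + T (exp Y)"
    unfolding f_def g0 by simp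
  have f1: "f 1 (1/2) = T ((exp X - exp Y) * (X - Y))"
    unfolding f_def g1 by (simp add: left_diff_distrib right_diff_distrib T_diff T_commute[of _ "exp Y"])
  show ?thesis using ineq unfolding f4 f03 f01 f1 by simp
qed


section \<open>Trace-one elements and the coincidence of the two entropies\<close>

lemma posinv_T_pos:
  assumes "posinv a"
  shows "0 < T a"
proof -
  obtain l where l: "sa l" "a = exp l" using assms by (rule posinvE)
  define c where "c = exp ((1/2) *\<^sub>R l)"
  have "sa c" "c * c = a" unfolding c_def exp_half_mult_self using l by auto
  moreover have "c \<noteq> 0"
    using exp_mult_exp_minus[of "(1/2) *\<^sub>R l"] unfolding c_def by (metis mult_zero_left zero_neq_one)
  ultimately show ?thesis
    using T_sa_square_nonneg[of c] T_sa_square_eq_0[of c] by fastforce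
qed

lemma posinv_normalize: "posinv a \<Longrightarrow> a /\<^sub>R T a \<in> dens st \<tau>"
  using posinv_T_pos[of a] by (simp add: dens_iff posinv_scaleR T_scaleR)

lemma dens_convex:
  assumes "a \<in> dens st \<tau>" "b \<in> dens st \<tau>" "0 < s" "s < 1"
  shows "(1 - s) *\<^sub>R b + s *\<^sub>R a \<in> dens st \<tau>"
  using assms by (auto simp: dens_iff T_add T_scaleR intro!: posinv_add posinv_scaleR)

lemma dens_midpoint:
  "a \<in> dens st \<tau> \<Longrightarrow> b \<in> dens st \<tau> \<Longrightarrow> (1/2) *\<^sub>R (a + b) \<in> dens st \<tau>"
  using dens_convex[of b a "1/2"] by (simp add: scaleR_right_distrib)

lemma bel_stas_1_right: "posinv A \<Longrightarrow> bel_stas A 1 = T (A * lg A)"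
  using bel_stas_bounds(3,4)[of A 1] cinv_eqI[of "1::'a" 1] by simp

text \<open>Both entropies are quadratically small near the diagonal, whereas a midpoint affine
  function which is quadratically small at a point vanishes.\<close>

lemma bel_stas_eq_umegaki_dens:
  assumes mid: "\<And>A A' B. A \<in> dens st \<tau> \<Longrightarrow> A' \<in> dens st \<tau> \<Longrightarrow> B \<in> dens st \<tau> \<Longrightarrow>
      2 * (bel_stas ((1/2) *\<^sub>R (A + A')) B - T ((1/2) *\<^sub>R (A + A') * lg ((1/2) *\<^sub>R (A + A')))) =
      (bel_stas A B - T (A * lg A)) + (bel_stas A' B - T (A' * lg A'))"
    and A: "A \<in> dens st \<tau>" and B: "B \<in> dens st \<tau>"
  shows "bel_stas A B = umegaki A B"
proof -
  define G where "G = (\<lambda>A. bel_stas A B - umegaki A B)"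
  have umegaki: "umegaki A B = T (A * lg A) - T (A * lg B)" for A
    by (simp add: umegaki_def right_diff_distrib T_diff)
  define c where "c = T ((A - B) * (A - B) * cinv B)"
  \<comment> \<open>Each point is the midpoint of its predecessor and \<open>B\<close>, so affinity
    scales \<open>G\<close> by 1/2 per step while the quadratic bound shrinks by 1/4.\<close>
  define P where "P = (\<lambda>n. (1 - (1/2)^n) *\<^sub>R B + ((1/2)^n) *\<^sub>R A)"
  have P_alt: "P n = B + ((1/2)^n) *\<^sub>R (A - B)" for n
    by (simp add: P_def algebra_simps)
  have Pd: "P n \<in> dens st \<tau>" for n
  proof (cases n)
    case 0
    then show ?thesis using A by (simp add: P_def)
  next
    case (Suc m)
    have "(1/2::real) ^ Suc m < 1" by (rule power_Suc_less_one) simp_all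
    then show ?thesis unfolding P_def Suc using A B by (intro dens_convex) simp_all
  qed
  have Bp: "posinv B" "T B = 1" "T A = 1" using A B by (simp_all add: dens_iff)
  have Binv: "B * cinv B = 1" "cinv B * B = 1" using cinv_exp[of "lg B"] exp_lg[OF Bp(1)] by (metis exp_mult_exp_minus)+
  have bounds: "\<bar>G C\<bar> \<le> T (C * C * cinv B) - 1" if "C \<in> dens st \<tau>" for C
    using umegaki_bounds[of C B] bel_stas_bounds(1,2)[of C B] that Bp unfolding G_def dens_iff by simp
  have G0: "G B = 0" using bounds[OF B] Bp by (simp add: mult.assoc Binv)
  have "P (Suc n) = (1/2) *\<^sub>R (P n + B)" for n
    unfolding P_alt by (simp add: algebra_simps) (simp flip: scaleR_left.add)
  moreover have "2 * G ((1/2) *\<^sub>R (C + B)) = G C" if "C \<in> dens st \<tau>" for C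
  proof -
    have "2 * T ((1/2) *\<^sub>R (C + B) * lg B) = T (C * lg B) + T (B * lg B)"
      by (simp add: distrib_right T_add T_scaleR)
    then show ?thesis using mid[OF that B B] G0 unfolding G_def umegaki by simp
  qed
  ultimately have step: "2 * G (P (Suc n)) = G (P n)" for n using Pd by simp
  have G: "G (P n) = (1/2)^n * G A" for n
  proof (induction n)
    case 0
    show ?case by (simp add: P_def)
  next
    case (Suc n)
    then show ?case using step[of n] by simp
  qed
  \<comment> \<open>The first-order term vanishes because \<open>A\<close> and \<open>B\<close> have
    equal trace.\<close>
  have quad: "T (P n * P n * cinv B) - 1 = (1/2)^n * (1/2)^n * c" for n
  proof -
    define s where "s = ((1/2)^n :: real)"
    define D where "D = A - B"
    have "P n = B + s *\<^sub>R D" by (simp add: P_alt s_def D_def)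
    then have "P n * P n * cinv B = B * (B * cinv B) + s *\<^sub>R (B * D * cinv B) + s *\<^sub>R (D * (B * cinv B))
        + (s * s) *\<^sub>R (D * D * cinv B)"
      by (simp add: algebra_simps)
    moreover have "T (B * D * cinv B) = T D"
      by (metis Binv(2) T_commute mult.assoc mult.left_neutral)
    moreover have "T D = 0" using Bp by (simp add: D_def T_diff)
    ultimately show ?thesis using Bp by (simp add: Binv T_add T_scaleR c_def s_def D_def)
  qed
  have le: "\<bar>G A\<bar> \<le> (1/2)^n * c" for n
  proof -
    have "(1/2)^n * \<bar>G A\<bar> \<le> (1/2)^n * ((1/2)^n * c)"
      using bounds[OF Pd[of n]] unfolding quad G by (simp add: abs_mult mult.assoc)
    then show ?thesis by (rule mult_left_le_imp_le) simp
  qed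
  have "(\<lambda>n. (1/2)^n * c) \<longlonglongrightarrow> 0 * c"
    by (intro tendsto_mult tendsto_const LIMSEQ_power_zero) simp
  then have "\<bar>G A\<bar> \<le> 0 * c" using le by (intro LIMSEQ_le_const) auto
  then show ?thesis by (simp add: G_def)
qed

text \<open>Both entropies obey the same scaling law, so normalising both arguments
  suffices.\<close>

lemma bel_stas_eq_umegaki_posinv:
  assumes "\<And>A B. A \<in> dens st \<tau> \<Longrightarrow> B \<in> dens st \<tau> \<Longrightarrow> bel_stas A B = umegaki A B"
    and "posinv A" "posinv B"
  shows "bel_stas A B = umegaki A B"
proof -
  have pos: "0 < T A" "0 < T B" using assms posinv_T_pos by auto
  define A' B' where "A' = A /\<^sub>R T A" and "B' = B /\<^sub>R T B"
  have d: "A' \<in> dens st \<tau>" "B' \<in> dens st \<tau>" using assms posinv_normalize by (auto simp: A'_def B'_def)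
  then have p: "posinv A'" "posinv B'" by (simp_all add: dens_iff)
  have AB: "A = T A *\<^sub>R A'" "B = T B *\<^sub>R B'" using pos by (simp_all add: A'_def B'_def)
  have "bel_stas (T A *\<^sub>R A') (T B *\<^sub>R B') = umegaki (T A *\<^sub>R A') (T B *\<^sub>R B')"
    using assms(1)[OF d] pos p
    by (simp add: bel_stas_scaleR umegaki_scaleR_right umegaki_scaleR_left posinv_scaleR T_scaleR algebra_simps)
  then show ?thesis using AB by simp
qed

subsection \<open>Equality of the entropies forces commutativity\<close>

lemma T_norm_bound:
  obtains K where "0 \<le> K" "\<And>x. \<bar>T x\<bar> \<le> norm x * K"
  using bounded_linear.nonneg_bounded[OF bounded_linear_T] by auto

text \<open>With \<open>v = exp (- X / 2)\<close> and \<open>u = v * (exp Y - exp X) * v\<close> one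
  has \<open>exp (- q) = 1 + u\<close>, so \<open>q\<close> is \<open>- u + u * u / 2\<close> up to
  third order; cyclicity evaluates the traces of \<open>exp X * u\<close> and
  \<open>exp X * (u * u)\<close>.\<close>

lemma bel_stas_second_order:
  assumes "0 \<le> K" "\<And>x. \<bar>T x\<bar> \<le> norm x * K" "sa X" "sa Y" "norm X \<le> M"
    and small: "exp M * norm (exp Y - exp X) \<le> 1/2"
  shows "(T (exp Y * exp Y * exp (- X)) - 2 * T (exp Y) + T (exp X)) / 2 + T (exp X) - T (exp Y)
      - 2 * K * exp (4 * M) * norm (exp Y - exp X) ^ 3 \<le> bel_stas (exp X) (exp Y)"
proof -
  obtain q where q: "sa q" "exp q = exp ((1/2) *\<^sub>R X) * exp (- Y) * exp ((1/2) *\<^sub>R X)"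
    and bel_stas: "bel_stas (exp X) (exp Y) = T (exp X * q)"
    using bel_stas_exp[OF assms(3,4)] by metis
  define w v where "w = exp ((1/2) *\<^sub>R X)" and "v = exp (- ((1/2) *\<^sub>R X))"
  have wv: "w * w = exp X" "v * v = exp (- X)" "w * v = 1" "v * w = 1" "sa v"
    using assms exp_half_mult_self[of "- X"] by (auto simp: w_def v_def exp_half_mult_self)
  define D where "D = exp Y - exp X"
  define u where "u = v * D * v"
  have "v * exp X * v = (v * w) * (w * v)" by (simp only: wv(1)[symmetric] mult.assoc)
  then have u1: "1 + u = v * exp Y * v"
    using wv by (simp add: u_def D_def algebra_simps)
  have "(1 + u) * exp q = v * exp Y * (v * w) * exp (- Y) * w"
    by (simp only: u1 q(2) w_def[symmetric] mult.assoc)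
  also have "\<dots> = v * (exp Y * exp (- Y)) * w" by (simp only: wv mult.assoc mult.left_neutral)
  finally have "(1 + u) * exp q * exp (- q) = exp (- q)" by (simp add: wv)
  then have expq: "exp (- q) = 1 + u" by (simp add: mult.assoc)
  have M: "norm w * norm w \<le> exp M" "norm v * norm v \<le> exp M"
  proof -
    have "norm ((1/2) *\<^sub>R X) \<le> M / 2" using assms(5) by simp
    then have e: "exp (norm ((1/2) *\<^sub>R X)) \<le> exp (M/2)" by (simp only: exp_le_cancel_iff)
    have "norm w \<le> exp (M/2)" "norm v \<le> exp (M/2)"
      unfolding w_def v_def
      using order_trans[OF norm_exp e] order_trans[OF norm_exp e[folded norm_minus_cancel[of "(1/2) *\<^sub>R X"]]]
      by (simp_all only:)
    then have "norm w * norm w \<le> exp (M/2) * exp (M/2)" "norm v * norm v \<le> exp (M/2) * exp (M/2)"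
      using mult_mono[of "norm w" "exp (M/2)" "norm w" "exp (M/2)"]
        mult_mono[of "norm v" "exp (M/2)" "norm v" "exp (M/2)"] by simp_all
    then show "norm w * norm w \<le> exp M" "norm v * norm v \<le> exp M" by (simp_all add: mult_exp_exp)
  qed
  have nX: "norm (exp X) \<le> exp M"
    using norm_mult_ineq[of w w] M unfolding wv by linarith
  have nu: "norm u \<le> exp M * norm D"
  proof -
    have "norm u \<le> norm v * norm D * norm v"
      unfolding u_def by (meson mult_right_mono norm_ge_zero norm_mult_ineq order_trans)
    also have "\<dots> \<le> exp M * norm D" using mult_right_mono[OF M(2), of "norm D"] by (simp add: mult_ac)
    finally show ?thesis .
  qed
  have u_small: "norm (- u) \<le> 1/2" using nu small by (simp add: D_def)
  define l where "l = (\<Sum>n. (- u) ^ Suc n /\<^sub>R Suc n)"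
  have "sa u" unfolding u_def D_def using assms wv by auto
  then have "sa l" unfolding l_def using u_small by (intro sa_log_series) auto
  have "exp (- l) = exp (- q)"
    unfolding expq l_def using has_log(1)[of "- u"] u_small by simp
  then have "l = q" using exp_inj_sa[of "- l" "- q"] \<open>sa l\<close> q by auto
  then have err: "norm (q + u - (u * u) /\<^sub>R 2) \<le> 2 * norm u ^ 3"
    using log_series_second_order[OF u_small] by (simp add: l_def)
  define e where "e = q + u - (u * u) /\<^sub>R 2"
  have Tu: "T (exp X * u) = T (exp Y) - T (exp X)"
  proof -
    have "T (exp X * u) = T (w * (w * v) * D * v)" by (simp only: u_def wv(1)[symmetric] mult.assoc)
    also have "\<dots> = T (D * (v * w))" by (metis T_commute mult.assoc mult.right_neutral wv(3))
    finally show ?thesis by (simp add: wv D_def T_diff)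
  qed
  have Tuu: "T (exp X * (u * u)) = T (exp Y * exp Y * exp (- X)) - 2 * T (exp Y) + T (exp X)"
  proof -
    have "T (exp X * (u * u)) = T (w * (w * v) * D * (v * v) * D * v)"
      by (simp only: u_def wv(1)[symmetric] mult.assoc)
    also have "\<dots> = T (w * (D * (v * v) * D * v))" by (simp only: wv(3) mult_1_right mult.assoc)
    also have "\<dots> = T (D * exp (- X) * D * (v * w))"
      unfolding wv(2)[symmetric] by (subst T_commute) (simp only: mult.assoc)
    also have "\<dots> = T (exp Y * exp (- X) * exp Y - exp Y * (exp (- X) * exp X) - (exp X * exp (- X)) * exp Y
        + (exp X * exp (- X)) * exp X)"
      by (simp only: D_def wv mult_1_right) (simp add: algebra_simps)
    finally show ?thesis by (simp add: T_diff T_add mult.assoc T_commute[of "exp (- X)"] T_commute[of "exp Y" "exp (- X) * exp Y"])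
  qed
  have "bel_stas (exp X) (exp Y) = T (exp X * (e - u + (u * u) /\<^sub>R 2))" by (simp add: bel_stas e_def)
  also have "\<dots> = T (exp X * e) - T (exp X * u) + T (exp X * (u * u)) / 2"
    by (simp add: distrib_left right_diff_distrib T_add T_diff T_scaleR)
  finally have "bel_stas (exp X) (exp Y) = T (exp X * e) + T (exp X) - T (exp Y)
      + (T (exp Y * exp Y * exp (- X)) - 2 * T (exp Y) + T (exp X)) / 2"
    unfolding Tu Tuu by simp
  \<comment> \<open>One factor \<open>exp M\<close> comes from \<open>exp X\<close>, three from the
    cube of the bound on \<open>u\<close>.\<close>
  moreover have "\<bar>T (exp X * e)\<bar> \<le> 2 * K * exp (4 * M) * norm D ^ 3"
  proof -
    have "norm e \<le> 2 * (exp M * norm D) ^ 3"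
      unfolding e_def using err power_mono[OF nu norm_ge_zero, of 3] by linarith
    then have "norm (exp X * e) \<le> exp M * (2 * (exp M * norm D) ^ 3)"
      by (intro order_trans[OF norm_mult_ineq] mult_mono nX) auto
    then have "\<bar>T (exp X * e)\<bar> \<le> exp M * (2 * (exp M * norm D) ^ 3) * K"
      using assms(1,2) by (meson mult_right_mono order_trans)
    also have "\<dots> = 2 * K * (exp M * exp M ^ 3) * norm D ^ 3" by (simp add: power_mult_distrib)
    also have "exp M * exp M ^ 3 = exp (4 * M)"
      using exp_of_nat_mult[of 4 M] by (simp add: power_Suc[symmetric] del: power_Suc)
    finally show ?thesis .
  qed
  ultimately show ?thesis by (simp add: D_def abs_le_iff)
qed

text \<open>For \<open>exp (Y + t W)\<close> and \<open>exp Y\<close> the second-order lower bounds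
  nearly exhaust the symmetric gap inequality, leaving only order t^3 for its t^2 correction
  term.\<close>

lemma sa_commute_if_bel_stas_eq_umegaki:
  assumes eq: "\<And>A B. posinv A \<Longrightarrow> posinv B \<Longrightarrow> bel_stas A B = umegaki A B"
    and Y: "sa Y" and W: "sa W"
  shows "Y * W = W * Y"
proof -
  obtain K where K: "0 \<le> K" "\<And>x. \<bar>T x\<bar> \<le> norm x * K" using T_norm_bound by blast
  define M where "M = norm Y + norm W"
  define X where "X = (\<lambda>t. Y + t *\<^sub>R W)"
  \<comment> \<open>\<open>t\<close> times this is the correction element of
    \<open>umegaki_symmetric_gap\<close>; at \<open>t = 0\<close> its middle factor is the
    commutator of \<open>Y\<close> and \<open>W\<close>.\<close>
  define z where "z = (\<lambda>t. exp ((1/4) *\<^sub>R X t) * (X t * W - W * Y) * exp ((1/4) *\<^sub>R Y))"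
  \<comment> \<open>384 = 96 * 4: the gap has factor 1/96, and each of the two expansions has error
    constant 2.\<close>
  define C where "C = 384 * K * exp (4 * M) * (exp M * norm W) ^ 3"
  have Ylim: "(X \<longlongrightarrow> Y) (at_right 0)"
    unfolding X_def by (auto intro!: tendsto_eq_intros)
  have "\<forall>\<^sub>F t in at_right (0::real). exp M * (exp M * norm W * t) < 1/2"
    by (rule order_tendstoD(2)[of _ 0]) (auto intro!: tendsto_eq_intros)
  moreover have "\<forall>\<^sub>F t in at_right (0::real). 0 < t \<and> t < 1"
    by (auto simp: eventually_at_right_field intro!: exI[of _ 1])
  ultimately have ev: "\<forall>\<^sub>F t in at_right 0. T (st (z t) * z t) \<le> C * t"
  proof eventually_elim
    case (elim t)
    have sX: "sa (X t)" using Y W by (auto simp: X_def)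
    have nX: "norm (X t) \<le> M" "norm Y \<le> M"
    proof -
      have "norm (t *\<^sub>R W) \<le> norm W" using elim by (simp add: mult_left_le_one_le)
      then show "norm (X t) \<le> M" unfolding X_def M_def by (meson add_left_mono norm_triangle_ineq order_trans)
    qed (simp add: M_def)
    have d: "norm (exp Y - exp (X t)) \<le> exp M * norm W * t"
      using exp_lipschitz[OF nX(2,1)] elim by (simp add: X_def mult_ac)
    then have small: "exp M * norm (exp Y - exp (X t)) \<le> 1/2"
      using elim(1) by (intro order_trans[OF mult_left_mono[OF d]]) auto
    have small': "exp M * norm (exp (X t) - exp Y) \<le> 1/2"
      using small by (simp add: norm_minus_commute)
    have cube: "norm (exp Y - exp (X t)) ^ 3 \<le> (exp M * norm W) ^ 3 * t ^ 3"
      using power_mono[OF d, of 3] by (simp add: power_mult_distrib)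
    have sum: "bel_stas (exp (X t)) (exp Y) + bel_stas (exp Y) (exp (X t)) = T ((exp (X t) - exp Y) * (X t - Y))"
      using sX Y by (simp add: eq umegaki_def algebra_simps T_diff T_add)
    have zt: "t *\<^sub>R z t = exp ((1/4) *\<^sub>R X t) * (X t * (X t - Y) - (X t - Y) * Y) * exp ((1/4) *\<^sub>R Y)"
      by (simp add: z_def X_def algebra_simps)
    have nc: "norm (exp (X t) - exp Y) = norm (exp Y - exp (X t))" by (rule norm_minus_commute)
    \<comment> \<open>The main terms of the two lower bounds add up to exactly
      \<open>(v + u - a - b) / 2\<close>.\<close>
    have lin: "d / 96 \<le> 4 * K * e * n" if "p + q = g" "(u - 2 * b + a) / 2 + a - b - 2 * K * e * n \<le> p"
      "(v - 2 * a + b) / 2 + b - a - 2 * K * e * n \<le> q" "g + d / 96 \<le> (v + u - a - b) / 2"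
      for a b d e n p q g u v :: real
      using that by (simp add: field_simps)
    have "T (st (t *\<^sub>R z t) * (t *\<^sub>R z t)) / 96 \<le> 4 * K * exp (4 * M) * norm (exp Y - exp (X t)) ^ 3"
      by (rule lin[OF sum bel_stas_second_order[OF K sX Y nX(1) small]
          bel_stas_second_order[OF K Y sX nX(2) small', unfolded nc] umegaki_symmetric_gap[OF sX Y, folded zt]])
    also have "\<dots> \<le> 4 * K * exp (4 * M) * ((exp M * norm W) ^ 3 * t ^ 3)"
      using K by (intro mult_left_mono cube) auto
    finally have "t\<^sup>2 * T (st (z t) * z t) \<le> t\<^sup>2 * (C * t)"
      by (simp add: st_scaleR T_scaleR C_def power2_eq_square power3_eq_cube algebra_simps)
    then show ?case using elim by simp
  qed
  have "((\<lambda>t. T (st (z t) * z t)) \<longlongrightarrow> T (st (z 0) * z 0)) (at_right 0)"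
  proof -
    have "(z \<longlongrightarrow> exp ((1/4) *\<^sub>R Y) * (Y * W - W * Y) * exp ((1/4) *\<^sub>R Y)) (at_right 0)"
      unfolding z_def by (intro tendsto_intros tendsto_exp_banach Ylim)
    then have "(z \<longlongrightarrow> z 0) (at_right 0)" by (simp add: z_def X_def)
    then show ?thesis
      by (intro bounded_linear.tendsto[OF bounded_linear_T] tendsto_mult bounded_linear.tendsto[OF bounded_linear_st])
  qed
  moreover have "((\<lambda>t. C * t) \<longlongrightarrow> 0) (at_right 0)" by (auto intro!: tendsto_eq_intros)
  ultimately have "T (st (z 0) * z 0) \<le> 0"
    using ev by (intro tendsto_le[of "at_right 0" "\<lambda>t. C * t" 0]) auto
  then have "z 0 = 0" using T_st_mult_eq_0 T_st_mult_nonneg by (meson order_antisym)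
  then have "exp (- ((1/4) *\<^sub>R Y)) * z 0 * exp (- ((1/4) *\<^sub>R Y)) = 0" by simp
  also have "exp (- ((1/4) *\<^sub>R Y)) * z 0 * exp (- ((1/4) *\<^sub>R Y)) =
     (exp (- ((1/4) *\<^sub>R Y)) * exp ((1/4) *\<^sub>R Y)) * (Y * W - W * Y) * (exp ((1/4) *\<^sub>R Y) * exp (- ((1/4) *\<^sub>R Y)))"
    by (simp only: z_def X_def mult.assoc scaleR_zero_left add_0_right)
  finally show ?thesis by simp
qed

lemma commutative_if_sa_commute:
  assumes "\<And>x y. sa x \<Longrightarrow> sa y \<Longrightarrow> x * y = y * x"
  shows "commutative_alg TYPE('a)"
  unfolding commutative_alg_def
proof (intro allI)
  fix x y :: 'a
  obtain h k where x: "sa h" "sa k" "x = h + j * k" by (rule sa_decompose)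
  obtain h' k' where y: "sa h'" "sa k'" "y = h' + j * k'" by (rule sa_decompose)
  have hk: "h * h' = h' * h" "h * k' = k' * h" "k * h' = h' * k" "k * k' = k' * k"
    using assms x y by auto
  have jl: "a * (j * b) = j * (a * b)" for a b by (metis j_commute mult.assoc)
  show "x * y = y * x"
    unfolding x(3) y(3)
    by (simp add: distrib_left distrib_right mult.assoc jl[of h] jl[of k] jl[of h'] jl[of k'] hk)
qed


section \<open>Separation by positive invertible elements, and Cartesian parts\<close>

lemma posinv_shift:
  assumes "sa x"
  obtains r where "0 < r" "posinv (r *\<^sub>R 1 + x)"
proof
  show "0 < norm x + 1" by (simp add: add_nonneg_pos)
  have "norm ((norm x + 1) *\<^sub>R 1 - ((norm x + 1) *\<^sub>R 1 + x)) < norm x + 1" by simp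
  then show "posinv ((norm x + 1) *\<^sub>R 1 + x)"
    using sa_log_ball assms by (metis posinv_exp sa_1 sa_add sa_scaleR)
qed

text \<open>\<open>x\<close> is the difference of the positive invertible elements
  \<open>r + x\<close> and \<open>r\<close>, so it can be tested against itself.\<close>

lemma posinv_separate:
  assumes "sa x" "\<And>b. posinv b \<Longrightarrow> T (b * x) = 0"
  shows "x = 0"
proof -
  obtain r where r: "0 < r" "posinv (r *\<^sub>R 1 + x)" using posinv_shift assms(1) by blast
  have "T ((r *\<^sub>R 1 + x) * x) = 0" "T ((r *\<^sub>R 1) * x) = 0"
    using assms(2) r posinv_scaleR(1)[OF posinv_1] by blast+
  then have "T (x * x) = 0" by (simp add: distrib_right T_add)
  then show ?thesis using T_sa_square_eq_0 assms(1) by blast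
qed

lemma T_exp_has_derivative:
  "((\<lambda>t. T (c * (exp (t *\<^sub>R X) * z))) has_real_derivative T (c * (exp (t *\<^sub>R X) * (X * z)))) (at t)"
  using T_flow_has_derivative[of c X 0 z t] by (simp add: flow_def twist_def)

definition re :: "'a \<Rightarrow> 'a" where "re x = (SOME h. sa h \<and> (\<exists>k. sa k \<and> x = h + j * k))"
definition im :: "'a \<Rightarrow> 'a" where "im x = - (j * (x - re x))"

lemma re_plus_j: "sa h \<Longrightarrow> sa k \<Longrightarrow> re (h + j * k) = h"
proof -
  assume hk: "sa h" "sa k"
  have "h' = h" if "sa h'" "sa k'" "h + j * k = h' + j * k'" for h' k'
    using sa_plus_j_eq_0(1)[of "h' - h" "k' - k"] hk that by (auto simp: algebra_simps)
  then show ?thesis unfolding re_def using hk by (intro some_equality) auto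
qed

lemma im_plus_j: "sa h \<Longrightarrow> sa k \<Longrightarrow> im (h + j * k) = k"
  by (simp add: im_def re_plus_j j_j_mult)

end

section \<open>Maps carrying the Belavkin-Staszewski entropy to the Umegaki entropy\<close>

locale entropy_map = A: traced_cstar_algebra stA jA \<tau> + B: traced_cstar_algebra stB jB \<omega>
  for stA :: "'a::{real_normed_algebra_1,banach} \<Rightarrow> 'a" and jA \<tau>
    and stB :: "'b::{real_normed_algebra_1,banach} \<Rightarrow> 'b" and jB \<omega> +
  fixes \<phi> :: "'a \<Rightarrow> 'b"
  assumes surj: "\<phi> ` dens stA \<tau> = dens stB \<omega>"
    and preserves: "\<And>X Y. X \<in> dens stA \<tau> \<Longrightarrow> Y \<in> dens stA \<tau> \<Longrightarrow>
      S_U stB \<omega> (\<phi> X) (\<phi> Y) = S_BS stA \<tau> X Y"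
begin

lemma phi_dens: "X \<in> dens stA \<tau> \<Longrightarrow> \<phi> X \<in> dens stB \<omega>"
  using surj by blast

lemma preserves_real:
  assumes "X \<in> dens stA \<tau>" "Y \<in> dens stA \<tau>"
  shows "B.umegaki (\<phi> X) (\<phi> Y) = A.bel_stas X Y"
proof -
  have "complex_of_real (B.umegaki (\<phi> X) (\<phi> Y)) = complex_of_real (A.bel_stas X Y)"
    using preserves[OF assms] B.S_U_eq[of "\<phi> X" "\<phi> Y"] A.S_BS_eq[of X Y] assms
      phi_dens[OF assms(1)] phi_dens[OF assms(2)]
    by (simp add: A.dens_iff B.dens_iff)
  then show ?thesis by simp
qed

subsection \<open>Midpoints\<close>

text \<open>For the Umegaki entropy the analogous expression is \<open>- T (X * lg Y)\<close>, which
  is affine in \<open>X\<close>.\<close>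

abbreviation E :: "'a \<Rightarrow> 'a \<Rightarrow> real" where
  "E X Y \<equiv> A.bel_stas X Y - A.T (X * A.lg X)"

text \<open>The Umegaki entropy is affine in its first argument up to a term not involving the second
  one, which pulls back to the Belavkin--Staszewski entropy.\<close>

lemma midpoint_preimage_affine:
  assumes X: "X \<in> dens stA \<tau>" "X' \<in> dens stA \<tau>" "Z \<in> dens stA \<tau>"
    and Z: "\<phi> Z = (1/2) *\<^sub>R (\<phi> X + \<phi> X')" and Y: "A.posinv Y"
  shows "E X Y + E X' Y = 2 * E Z Y"
proof -
  define k where "k = B.T (\<phi> X * B.lg (\<phi> X)) + B.T (\<phi> X' * B.lg (\<phi> X')) - 2 * B.T (\<phi> Z * B.lg (\<phi> Z))"
  have dens: "A.bel_stas X V + A.bel_stas X' V - 2 * A.bel_stas Z V = k" if V: "V \<in> dens stA \<tau>" for V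
  proof -
    have "2 * B.T (\<phi> Z * B.lg (\<phi> V)) = B.T (\<phi> X * B.lg (\<phi> V)) + B.T (\<phi> X' * B.lg (\<phi> V))"
      unfolding Z by (simp add: distrib_right B.T_add B.T_scaleR)
    then show ?thesis
      using X V unfolding preserves_real[symmetric, OF _ V] preserves_real[OF X(1) V, symmetric]
        preserves_real[OF X(2) V, symmetric] preserves_real[OF X(3) V, symmetric]
      by (simp add: k_def B.umegaki_def right_diff_distrib B.T_diff)
  qed
  \<comment> \<open>Rescaling \<open>V\<close> shifts all three entropies by the same logarithm, and
    the coefficients 1, 1, -2 add up to 0.\<close>
  have posinv: "A.bel_stas X V + A.bel_stas X' V - 2 * A.bel_stas Z V = k" if V: "A.posinv V" for V
  proof -
    have t: "0 < A.T V" using V by (rule A.posinv_T_pos)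
    have "A.bel_stas U (V /\<^sub>R A.T V) = A.bel_stas U V + ln (A.T V)" if "U \<in> dens stA \<tau>" for U
      using A.bel_stas_scaleR[of U V 1 "inverse (A.T V)"] that V t by (simp add: A.dens_iff ln_inverse)
    then show ?thesis using dens[OF A.posinv_normalize[OF V]] X by simp
  qed
  \<comment> \<open>Taking \<open>V = 1\<close> computes \<open>k\<close>.\<close>
  have "A.bel_stas U 1 = A.T (U * A.lg U)" if "U \<in> dens stA \<tau>" for U
    using that by (intro A.bel_stas_1_right) (simp add: A.dens_iff)
  then show ?thesis using posinv[OF Y] posinv[OF A.posinv_1] X by simp
qed

text \<open>Inserting \<open>Y = exp (- t K)\<close>, with a lower bound for \<open>Z\<close> and
  upper bounds for \<open>X\<close> and \<open>X'\<close>, yields \<open>4 \<le> f t\<close> with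
  equality at 0. The vanishing derivative there is \<open>T (K * K)\<close>.\<close>

lemma midpoint_preimage:
  assumes X: "X \<in> dens stA \<tau>" "X' \<in> dens stA \<tau>" "Z \<in> dens stA \<tau>"
    and Z: "\<phi> Z = (1/2) *\<^sub>R (\<phi> X + \<phi> X')"
  shows "Z = (1/2) *\<^sub>R (X + X')"
proof -
  define K where "K = X + X' - 2 *\<^sub>R Z"
  have p: "A.posinv X" "A.posinv X'" "A.posinv Z" "A.T X = 1" "A.T X' = 1" "A.T Z = 1"
    using X by (simp_all add: A.dens_iff)
  then have saK: "A.sa K" by (auto simp: K_def)
  define f where "f = (\<lambda>t. A.T ((X + X') * (exp (t *\<^sub>R K) * 1)) + 2 * A.T (Z * (exp (t *\<^sub>R - K) * 1)))"
  have "4 \<le> f t" for t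
  proof -
    have e: "A.posinv (exp (t *\<^sub>R - K))" "cinv (exp (t *\<^sub>R - K)) = exp (t *\<^sub>R K)"
      using saK by (auto intro!: A.posinv_exp)
    show ?thesis
      using midpoint_preimage_affine[OF X Z e(1)] A.bel_stas_bounds(3)[OF p(3) e(1)]
        A.bel_stas_bounds(4)[OF p(1) e(1)] A.bel_stas_bounds(4)[OF p(2) e(1)] p(4-6)
      unfolding f_def e(2) by (simp add: distrib_right A.T_add)
  qed
  moreover have "f 0 = 4" using p by (simp add: f_def A.T_add)
  moreover have "(f has_real_derivative A.T ((X + X') * (exp (0 *\<^sub>R K) * (K * 1))) +
      2 * A.T (Z * (exp (0 *\<^sub>R - K) * (- K * 1)))) (at 0)"
    unfolding f_def by (intro DERIV_add DERIV_cmult A.T_exp_has_derivative)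
  ultimately have "A.T ((X + X') * (exp (0 *\<^sub>R K) * (K * 1))) + 2 * A.T (Z * (exp (0 *\<^sub>R - K) * (- K * 1))) = 0"
    using DERIV_local_min[of f _ 0 1] by simp
  then have "A.T (K * K) = 0"
    unfolding K_def by (simp add: A.T_minus algebra_simps) (simp add: algebra_simps A.T_add A.T_diff A.T_scaleR)
  then have "K = 0" using saK A.T_sa_square_eq_0 by blast
  then have "X + X' = 2 *\<^sub>R Z" by (simp add: K_def)
  then show ?thesis by simp
qed

text \<open>Surjectivity provides a preimage of the midpoint of the images; being the midpoint
  itself, it makes \<open>E\<close> midpoint affine.\<close>

lemma bel_stas_eq_umegaki: "A.posinv X \<Longrightarrow> A.posinv Y \<Longrightarrow> A.bel_stas X Y = A.umegaki X Y"
proof (rule A.bel_stas_eq_umegaki_posinv[OF A.bel_stas_eq_umegaki_dens])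
  fix X X' Y assume d: "X \<in> dens stA \<tau>" "X' \<in> dens stA \<tau>" "Y \<in> dens stA \<tau>"
  have "(1/2) *\<^sub>R (\<phi> X + \<phi> X') \<in> \<phi> ` dens stA \<tau>"
    unfolding surj using d phi_dens by (intro B.dens_midpoint)
  then obtain Z where Z: "Z \<in> dens stA \<tau>" "\<phi> Z = (1/2) *\<^sub>R (\<phi> X + \<phi> X')" by force
  have "Z = (1/2) *\<^sub>R (X + X')" using midpoint_preimage d Z by blast
  then show "2 * E ((1/2) *\<^sub>R (X + X')) Y = E X Y + E X' Y"
    using midpoint_preimage_affine[OF d(1,2) Z] d(3) by (simp add: A.dens_iff)
qed

lemma commutative_A: "commutative_alg TYPE('a)"
  using A.commutative_if_sa_commute A.sa_commute_if_bel_stas_eq_umegaki bel_stas_eq_umegaki by blast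

lemma mult_commute_A: "x * y = y * (x::'a)"
  using commutative_A by (simp add: commutative_alg_def)

subsection \<open>The logarithmic coordinate map\<close>

text \<open>Chosen so that \<open>\<beta>\<close> times 1 has trace 1.\<close>

definition \<beta> :: real where "\<beta> = inverse (B.T 1)"

definition c0 :: 'a where "c0 = A.lg (SOME D. D \<in> dens stA \<tau> \<and> \<phi> D = \<beta> *\<^sub>R 1)"

definition lam :: "'a \<Rightarrow> real" where "lam Z = A.T (exp (c0 + Z))"

text \<open>The map \<open>N\<close> of the introduction. The scalar term undoes both
  normalisations, so that 0 goes to 0 and scalar shifts are preserved.\<close>

definition logmap :: "'a \<Rightarrow> 'b" where
  "logmap Z = B.lg (\<phi> (exp (c0 + Z) /\<^sub>R lam Z)) + (ln (lam Z) - ln \<beta>) *\<^sub>R 1"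

lemma beta_pos: "0 < \<beta>"
  using B.posinv_T_pos[of 1] by (simp add: \<beta>_def)

lemma exp_c0: "exp c0 \<in> dens stA \<tau>" "\<phi> (exp c0) = \<beta> *\<^sub>R 1" "A.sa c0"
proof -
  have "\<beta> *\<^sub>R 1 \<in> \<phi> ` dens stA \<tau>"
    unfolding surj \<beta>_def using B.posinv_normalize[of 1] by simp
  then have "\<exists>D. D \<in> dens stA \<tau> \<and> \<phi> D = \<beta> *\<^sub>R 1" by force
  then have D: "(SOME D. D \<in> dens stA \<tau> \<and> \<phi> D = \<beta> *\<^sub>R 1) \<in> dens stA \<tau>"
    "\<phi> (SOME D. D \<in> dens stA \<tau> \<and> \<phi> D = \<beta> *\<^sub>R 1) = \<beta> *\<^sub>R 1"
    using someI_ex[of "\<lambda>D. D \<in> dens stA \<tau> \<and> \<phi> D = \<beta> *\<^sub>R 1"] by blast+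
  then show "exp c0 \<in> dens stA \<tau>" "\<phi> (exp c0) = \<beta> *\<^sub>R 1" "A.sa c0"
    by (simp_all add: c0_def A.dens_iff)
qed

lemma lam_pos: "A.sa Z \<Longrightarrow> 0 < lam Z"
  unfolding lam_def using exp_c0 by (intro A.posinv_T_pos) auto

lemma normalized_exp_dens: "A.sa Z \<Longrightarrow> exp (c0 + Z) /\<^sub>R lam Z \<in> dens stA \<tau>"
  unfolding lam_def using exp_c0 by (intro A.posinv_normalize) auto

lemma sa_n [simp, intro]: "A.sa Z \<Longrightarrow> B.sa (logmap Z)"
  unfolding logmap_def using phi_dens[OF normalized_exp_dens]
  by (intro B.sa_add B.sa_scaleR) (auto simp: B.dens_iff)

lemma phi_normalized_exp:
  assumes "A.sa Z"
  shows "\<phi> (exp (c0 + Z) /\<^sub>R lam Z) = (\<beta> / lam Z) *\<^sub>R exp (logmap Z)"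
proof -
  let ?P = "\<phi> (exp (c0 + Z) /\<^sub>R lam Z)"
  have "exp (logmap Z) = exp (ln (lam Z) - ln \<beta>) *\<^sub>R ?P"
    using phi_dens[OF normalized_exp_dens[OF assms]] unfolding logmap_def exp_add_scalar
    by (simp add: B.dens_iff)
  also have "exp (ln (lam Z) - ln \<beta>) = lam Z / \<beta>"
    using lam_pos[OF assms] beta_pos by (simp add: exp_diff)
  finally show ?thesis using lam_pos[OF assms] beta_pos by simp
qed

text \<open>Subtracting two entropies with the same first argument cancels its logarithm and leaves
  an expression linear in the logarithms of the second arguments, here \<open>exp c0\<close> and the
  normalised \<open>exp (c0 + Z)\<close>.\<close>

lemma logmap_trace:
  assumes W: "A.sa W" and Z: "A.sa Z"
  shows "\<beta> * B.T (exp (logmap W) * logmap Z) = A.T (exp (c0 + W) * Z)"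
proof -
  let ?P = "\<lambda>Z. exp (c0 + Z) /\<^sub>R lam Z"
  note d = normalized_exp_dens[OF W] normalized_exp_dens[OF Z] exp_c0(1)
  have umegaki: "B.umegaki (\<phi> (?P W)) (\<phi> V) = A.umegaki (?P W) V" if "V \<in> dens stA \<tau>" for V
    using preserves_real[OF d(1) that] bel_stas_eq_umegaki d(1) that by (simp add: A.dens_iff)
  have lgP: "A.lg (?P Z) = c0 + Z - ln (lam Z) *\<^sub>R 1"
    using A.posinv_scaleR(2)[OF A.posinv_exp[OF A.sa_add[OF exp_c0(3) Z]], of "inverse (lam Z)"]
      A.sa_add[OF exp_c0(3) Z] lam_pos[OF Z]
    by (simp add: ln_inverse)
  have lgphi: "B.lg (\<phi> (?P Z)) = logmap Z - (ln (lam Z) - ln \<beta>) *\<^sub>R 1" by (simp add: logmap_def)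
  have lg0: "B.lg (\<phi> (exp c0)) = ln \<beta> *\<^sub>R 1"
    using B.clog_exp[of "0::'b"] B.posinv_scaleR(2)[of 1 \<beta>] beta_pos by (simp add: exp_c0)
  have T1: "A.T (?P W) = 1" "B.T (\<phi> (?P W)) = 1"
    using d(1) phi_dens[OF d(1)] by (simp_all only: A.dens_iff B.dens_iff)
  have "B.T (\<phi> (?P W) * (B.lg (\<phi> (?P Z)) - B.lg (\<phi> (exp c0)))) =
      B.umegaki (\<phi> (?P W)) (\<phi> (exp c0)) - B.umegaki (\<phi> (?P W)) (\<phi> (?P Z))"
    by (simp only: B.umegaki_def right_diff_distrib B.T_diff)
  also have "\<dots> = A.T (?P W * (A.lg (?P Z) - A.lg (exp c0)))"
    unfolding umegaki[OF d(2)] umegaki[OF d(3)] by (simp only: A.umegaki_def right_diff_distrib A.T_diff)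
  finally have "B.T (\<phi> (?P W) * logmap Z - ln (lam Z) *\<^sub>R \<phi> (?P W)) = A.T (?P W * Z - ln (lam Z) *\<^sub>R ?P W)"
    unfolding lgP lgphi lg0 by (simp add: exp_c0 algebra_simps)
  then have "B.T (\<phi> (?P W) * logmap Z) = A.T (?P W * Z)"
    unfolding A.T_diff B.T_diff A.T_scaleR[of "ln (lam Z)"] B.T_scaleR[of "ln (lam Z)"] T1 by simp
  then show ?thesis
    unfolding phi_normalized_exp[OF W] using lam_pos[OF W]
    by (simp add: A.T_scaleR B.T_scaleR field_simps)
qed

lemma logmap_of_dens:
  assumes "X \<in> dens stA \<tau>"
  shows "logmap (A.lg X - c0) = B.lg (\<phi> X) - ln \<beta> *\<^sub>R 1" "X = exp (c0 + (A.lg X - c0))"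
    "\<phi> X = \<beta> *\<^sub>R exp (logmap (A.lg X - c0))"
proof -
  have X: "A.posinv X" "A.T X = 1" using assms by (simp_all add: A.dens_iff)
  then have e: "exp (c0 + (A.lg X - c0)) = X" and l: "lam (A.lg X - c0) = 1" by (simp_all add: lam_def)
  show "X = exp (c0 + (A.lg X - c0))" using e by simp
  show "logmap (A.lg X - c0) = B.lg (\<phi> X) - ln \<beta> *\<^sub>R 1" unfolding logmap_def e l by simp
  show "\<phi> X = \<beta> *\<^sub>R exp (logmap (A.lg X - c0))"
    using phi_normalized_exp[of "A.lg X - c0"] X exp_c0(3) unfolding e l by auto
qed

lemma logmap_add_scalar:
  assumes "A.sa Z"
  shows "logmap (Z + r *\<^sub>R 1) = logmap Z + r *\<^sub>R 1"
proof -
  have e: "exp (c0 + (Z + r *\<^sub>R 1)) = exp r *\<^sub>R exp (c0 + Z)"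
    using exp_add_scalar[of "c0 + Z" r] by (simp add: add.assoc)
  have l: "lam (Z + r *\<^sub>R 1) = exp r * lam Z" unfolding lam_def e by (rule A.T_scaleR)
  have "exp (c0 + (Z + r *\<^sub>R 1)) /\<^sub>R lam (Z + r *\<^sub>R 1) = exp (c0 + Z) /\<^sub>R lam Z"
    unfolding e l by simp
  then show ?thesis
    unfolding logmap_def using lam_pos[OF assms] by (simp add: l ln_mult algebra_simps)
qed

lemma logmap_surj:
  assumes "B.sa y"
  obtains W where "A.sa W" "logmap W = y"
proof -
  define t where "t = B.T (exp y)"
  have t: "0 < t" unfolding t_def using assms B.posinv_T_pos by blast
  have "exp y /\<^sub>R t \<in> \<phi> ` dens stA \<tau>"
    unfolding surj t_def using assms by (intro B.posinv_normalize) auto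
  then obtain X where X: "X \<in> dens stA \<tau>" "\<phi> X = exp y /\<^sub>R t" by force
  have "B.lg (\<phi> X) = y - ln t *\<^sub>R 1"
    using B.posinv_scaleR(2)[of "exp y" "inverse t"] assms t X by (simp add: ln_inverse)
  then have logmap_X: "logmap (A.lg X - c0) = y - ln t *\<^sub>R 1 - ln \<beta> *\<^sub>R 1"
    using logmap_of_dens(1)[OF X(1)] by simp
  have s: "A.sa (A.lg X - c0)" using X exp_c0(3) by (auto simp: A.dens_iff)
  show ?thesis
  proof
    \<comment> \<open>The shift compensates the normalisation of \<open>exp y\<close> and the factor
      \<open>\<beta>\<close>.\<close>
    show "A.sa (A.lg X - c0 + (ln t + ln \<beta>) *\<^sub>R 1)" using s by auto
    show "logmap (A.lg X - c0 + (ln t + ln \<beta>) *\<^sub>R 1) = y"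
      unfolding logmap_add_scalar[OF s] logmap_X by (simp add: algebra_simps)
  qed
qed

text \<open>By surjectivity \<open>exp (logmap W)\<close> runs through all positive invertible
  elements, so \<open>logmap_trace\<close> determines \<open>logmap Z\<close>.\<close>

lemma logmap_separate:
  assumes "B.sa y" "\<And>W. A.sa W \<Longrightarrow> B.T (exp (logmap W) * y) = 0"
  shows "y = 0"
proof (rule B.posinv_separate[OF assms(1)])
  fix b assume "B.posinv b"
  then obtain l where l: "B.sa l" "b = exp l" by (rule B.posinvE)
  then obtain W where "A.sa W" "logmap W = l" using logmap_surj by blast
  then show "B.T (b * y) = 0" using assms(2) l by blast
qed

text \<open>The right-hand side of \<open>logmap_trace\<close> is additive in
  \<open>Z\<close>.\<close>

lemma logmap_add:
  assumes "A.sa Z" "A.sa Z'"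
  shows "logmap (Z + Z') = logmap Z + logmap Z'"
proof -
  have "logmap (Z + Z') - logmap Z - logmap Z' = 0"
  proof (rule logmap_separate)
    fix W assume W: "A.sa W"
    have "\<beta> * B.T (exp (logmap W) * (logmap (Z + Z') - logmap Z - logmap Z')) = 0"
      using logmap_trace[OF W A.sa_add[OF assms]] logmap_trace[OF W assms(1)] logmap_trace[OF W assms(2)]
      by (simp add: distrib_left right_diff_distrib B.T_diff A.T_add)
    then show "B.T (exp (logmap W) * (logmap (Z + Z') - logmap Z - logmap Z')) = 0" using beta_pos by simp
  qed (use assms in auto)
  then show ?thesis by (simp add: algebra_simps)
qed

lemma logmap_scaleR:
  assumes "A.sa Z"
  shows "logmap (r *\<^sub>R Z) = r *\<^sub>R logmap Z"
proof -
  have "logmap (r *\<^sub>R Z) - r *\<^sub>R logmap Z = 0"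
  proof (rule logmap_separate)
    fix W assume W: "A.sa W"
    have "\<beta> * B.T (exp (logmap W) * (logmap (r *\<^sub>R Z) - r *\<^sub>R logmap Z)) = 0"
      using logmap_trace[OF W A.sa_scaleR[OF assms, of r]] logmap_trace[OF W assms]
      by (simp add: right_diff_distrib B.T_diff B.T_scaleR A.T_scaleR)
    then show "B.T (exp (logmap W) * (logmap (r *\<^sub>R Z) - r *\<^sub>R logmap Z)) = 0" using beta_pos by simp
  qed (use assms in auto)
  then show ?thesis by simp
qed

lemma logmap_minus: "A.sa Z \<Longrightarrow> logmap (- Z) = - logmap Z"
  using logmap_scaleR[of Z "-1"] by simp

lemma logmap_diff: "A.sa Z \<Longrightarrow> A.sa Z' \<Longrightarrow> logmap (Z - Z') = logmap Z - logmap Z'"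
  using logmap_add[of Z "- Z'"] by (simp add: logmap_minus A.sa_minus)

lemma logmap_0 [simp]: "logmap 0 = 0"
  using logmap_scaleR[of 0 0] by simp

lemma logmap_1 [simp]: "logmap 1 = 1"
  using logmap_add_scalar[of 0 1] by simp

lemma logmap_eq_0:
  assumes "A.sa W" "logmap W = 0"
  shows "W = 0"
proof (rule A.posinv_separate[OF assms(1)])
  fix b assume b: "A.posinv b"
  have "A.sa (A.lg b - c0)" using b exp_c0(3) by auto
  from logmap_trace[OF this assms(1)] show "A.T (b * W) = 0" using b assms(2) by simp
qed

section \<open>Multiplicativity of the logarithmic coordinate and commutativity of the range\<close>

lemma sa_mult_A: "A.sa x \<Longrightarrow> A.sa y \<Longrightarrow> A.sa (x * y)"
  using A.sa_mult_commuting mult_commute_A by blast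

text \<open>By linearity \<open>W\<close> may be replaced by \<open>t W\<close> in
  \<open>logmap_trace\<close>; the first and second derivatives at \<open>t = 0\<close> are the
  claims.\<close>

lemma logmap_trace_moments:
  assumes W: "A.sa W" and Z: "A.sa Z"
  shows "\<beta> * B.T (logmap W * logmap Z) = A.T (exp c0 * (W * Z))"
    and "\<beta> * B.T (logmap W * (logmap W * logmap Z)) = A.T (exp c0 * (W * (W * Z)))"
proof -
  have e: "\<beta> * B.T (1 * (exp (t *\<^sub>R logmap W) * logmap Z)) = A.T (exp c0 * (exp (t *\<^sub>R W) * Z))" for t
    using logmap_trace[OF A.sa_scaleR[OF W] Z, of t] logmap_scaleR[OF W] exp_add_commuting[OF mult_commute_A, of c0 "t *\<^sub>R W"]
    by (simp add: mult.assoc)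
  \<comment> \<open>By \<open>e\<close> both sides are derivatives of the same function of
    \<open>t\<close>.\<close>
  have 1: "\<beta> * B.T (1 * (exp (t *\<^sub>R logmap W) * (logmap W * logmap Z))) = A.T (exp c0 * (exp (t *\<^sub>R W) * (W * Z)))" for t
    by (rule DERIV_unique[OF DERIV_cmult[OF B.T_exp_has_derivative]])
       (unfold e, rule A.T_exp_has_derivative)
  have 2: "\<beta> * B.T (1 * (exp (t *\<^sub>R logmap W) * (logmap W * (logmap W * logmap Z)))) = A.T (exp c0 * (exp (t *\<^sub>R W) * (W * (W * Z))))" for t
    by (rule DERIV_unique[OF DERIV_cmult[OF B.T_exp_has_derivative]])
       (unfold 1, rule A.T_exp_has_derivative)
  show "\<beta> * B.T (logmap W * logmap Z) = A.T (exp c0 * (W * Z))"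
    "\<beta> * B.T (logmap W * (logmap W * logmap Z)) = A.T (exp c0 * (W * (W * Z)))"
    using 1[of 0] 2[of 0] by simp_all
qed

lemma logmap_pair_separate:
  assumes "B.sa x" "\<And>Z. A.sa Z \<Longrightarrow> B.T (x * logmap Z) = 0"
  shows "x = 0"
  using logmap_surj[OF assms(1)] assms B.T_sa_square_eq_0 by metis

text \<open>The second moment of \<open>W\<close> equals the first moment of
  \<open>W * W\<close>.\<close>

lemma logmap_square:
  assumes W: "A.sa W"
  shows "logmap (W * W) = logmap W * logmap W"
proof -
  have "logmap (W * W) - logmap W * logmap W = 0"
  proof (rule logmap_pair_separate)
    fix Z assume Z: "A.sa Z"
    have "\<beta> * B.T ((logmap (W * W) - logmap W * logmap W) * logmap Z) = 0"
      using logmap_trace_moments[OF W Z] logmap_trace_moments(1)[OF A.sa_mult_self[OF W] Z]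
      by (simp add: left_diff_distrib B.T_diff right_diff_distrib mult.assoc)
    then show "B.T ((logmap (W * W) - logmap W * logmap W) * logmap Z) = 0" using beta_pos by simp
  qed (use W in auto)
  then show ?thesis by simp
qed

text \<open>\<open>logmap_trace\<close> at \<open>W\<close> is compared with the first moment of
  \<open>exp W\<close>; commutativity splits \<open>exp (c0 + W)\<close>.\<close>

lemma logmap_exp:
  assumes W: "A.sa W"
  shows "logmap (exp W) = exp (logmap W)"
proof -
  have "logmap (exp W) - exp (logmap W) = 0"
  proof (rule logmap_pair_separate)
    fix Z assume Z: "A.sa Z"
    have "\<beta> * B.T ((logmap (exp W) - exp (logmap W)) * logmap Z) = 0"
      using logmap_trace[OF W Z] logmap_trace_moments(1)[OF A.sa_exp[OF W] Z] exp_add_commuting[OF mult_commute_A, of c0 W]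
      by (simp add: left_diff_distrib B.T_diff right_diff_distrib mult.assoc)
    then show "B.T ((logmap (exp W) - exp (logmap W)) * logmap Z) = 0" using beta_pos by simp
  qed (use W in auto)
  then show ?thesis by simp
qed

lemma logmap_jordan:
  assumes "A.sa W" "A.sa Z"
  shows "2 *\<^sub>R logmap (W * Z) = logmap W * logmap Z + logmap Z * logmap W"
proof -
  have "(W + Z) * (W + Z) = W * W + 2 *\<^sub>R (W * Z) + Z * Z"
    by (simp add: algebra_simps scaleR_2 mult_commute_A[of Z W])
  then have "logmap ((W + Z) * (W + Z)) = logmap W * logmap W + 2 *\<^sub>R logmap (W * Z) + logmap Z * logmap Z"
    using assms by (simp add: logmap_add logmap_scaleR logmap_square sa_mult_A A.sa_add A.sa_scaleR A.sa_mult_self)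
  moreover have "logmap ((W + Z) * (W + Z)) = (logmap W + logmap Z) * (logmap W + logmap Z)"
    using assms by (simp add: logmap_square logmap_add A.sa_add)
  ultimately show ?thesis by (simp add: algebra_simps)
qed

text \<open>The Jordan product of \<open>B\<close> is associative, so commutators are central; applied to
  \<open>x\<close> and \<open>x z + z x\<close> this makes the square of the commutator of \<open>x\<close> and \<open>z\<close> vanish.\<close>

lemma commutator_central:
  assumes "B.sa x" "B.sa y" "B.sa z"
  shows "y * (x * z - z * x) = (x * z - z * x) * y"
proof -
  obtain W U Z where W: "A.sa W" "logmap W = x" and U: "A.sa U" "logmap U = y" and Z: "A.sa Z" "logmap Z = z"
    using assms logmap_surj by metis
  have "4 *\<^sub>R logmap (W * U * Z) = 2 *\<^sub>R (2 *\<^sub>R logmap (W * U * Z))" by simp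
  also have "\<dots> = 2 *\<^sub>R (logmap (W * U) * z + z * logmap (W * U))"
    unfolding logmap_jordan[OF sa_mult_A[OF W(1) U(1)] Z(1)] Z(2) ..
  also have "\<dots> = (2 *\<^sub>R logmap (W * U)) * z + z * (2 *\<^sub>R logmap (W * U))" by (simp add: scaleR_right_distrib)
  also have "\<dots> = (x * y + y * x) * z + z * (x * y + y * x)"
    unfolding logmap_jordan[OF W(1) U(1)] W(2) U(2) ..
  finally have 1: "4 *\<^sub>R logmap (W * U * Z) = (x * y + y * x) * z + z * (x * y + y * x)" .
  have "4 *\<^sub>R logmap (W * (U * Z)) = 2 *\<^sub>R (2 *\<^sub>R logmap (W * (U * Z)))" by simp
  also have "\<dots> = 2 *\<^sub>R (x * logmap (U * Z) + logmap (U * Z) * x)"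
    unfolding logmap_jordan[OF W(1) sa_mult_A[OF U(1) Z(1)]] W(2) ..
  also have "\<dots> = x * (2 *\<^sub>R logmap (U * Z)) + (2 *\<^sub>R logmap (U * Z)) * x" by (simp add: scaleR_right_distrib)
  also have "\<dots> = x * (y * z + z * y) + (y * z + z * y) * x"
    unfolding logmap_jordan[OF U(1) Z(1)] U(2) Z(2) ..
  finally have 2: "4 *\<^sub>R logmap (W * (U * Z)) = x * (y * z + z * y) + (y * z + z * y) * x" .
  from 1 2 show ?thesis by (simp add: algebra_simps)
qed

lemma sa_commute_B:
  assumes "B.sa x" "B.sa z"
  shows "x * z = z * x"
proof -
  define d where "d = x * z - z * x"
  have central: "y * d = d * y" if "B.sa y" for y
    unfolding d_def using commutator_central assms that by blast
  have "B.sa (x * z + z * x)" using assms by (simp add: B.sa_def B.st_add B.st_mult add.commute)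
  \<comment> \<open>The commutator of \<open>x\<close> with \<open>x * z + z * x\<close> is
    \<open>x * d + d * x\<close>, which equals \<open>2 x d\<close> because \<open>d\<close> is
    central.\<close>
  from commutator_central[OF assms(1) assms(2) this]
  have "z * (x * d + d * x) = (x * d + d * x) * z" by (simp add: d_def algebra_simps)
  then have "2 *\<^sub>R (z * x * d) = 2 *\<^sub>R (x * z * d)"
    using central[OF assms(1)] central[OF assms(2)]
    by (simp add: distrib_left distrib_right mult.assoc scaleR_2) (simp flip: mult.assoc)
  then have "z * x * d = x * z * d" by simp
  then have "d * d = 0" by (simp add: d_def algebra_simps)
  \<comment> \<open>\<open>d\<close> is skew-adjoint, so
    \<open>stB d * d = - (d * d) = 0\<close>.\<close>
  moreover have "stB d = - d" using assms by (simp add: d_def B.st_diff B.st_mult B.sa_st)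
  ultimately have "d = 0" using B.st_mult_self_eq_0[of d] by simp
  then show ?thesis by (simp add: d_def)
qed

lemma commutative_B: "commutative_alg TYPE('b)"
  using B.commutative_if_sa_commute sa_commute_B by blast

lemma mult_commute_B: "x * y = y * (x::'b)"
  using commutative_B by (simp add: commutative_alg_def)

lemma logmap_mult: "A.sa W \<Longrightarrow> A.sa Z \<Longrightarrow> logmap (W * Z) = logmap W * logmap Z"
  using logmap_jordan[of W Z] mult_commute_B[of "logmap Z" "logmap W"] by (simp flip: scaleR_2)

subsection \<open>The isomorphism\<close>

text \<open>The complex-linear extension of \<open>logmap\<close> from the self-adjoint
  part.\<close>

definition J :: "'a \<Rightarrow> 'b" where "J x = logmap (A.re x) + jB * logmap (A.im x)"

lemma J_plus_j: "A.sa h \<Longrightarrow> A.sa k \<Longrightarrow> J (h + jA * k) = logmap h + jB * logmap k"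
  by (simp add: J_def A.re_plus_j A.im_plus_j)

lemma J_sa: "A.sa h \<Longrightarrow> J h = logmap h"
  using J_plus_j[of h 0] by simp

lemma J_add: "J (x + y) = J x + J y"
proof -
  obtain h k where x: "A.sa h" "A.sa k" "x = h + jA * k" by (rule A.sa_decompose)
  obtain h' k' where y: "A.sa h'" "A.sa k'" "y = h' + jA * k'" by (rule A.sa_decompose)
  have "x + y = (h + h') + jA * (k + k')" by (simp add: x y algebra_simps)
  then have "J (x + y) = logmap (h + h') + jB * logmap (k + k')"
    using J_plus_j[OF A.sa_add[OF x(1) y(1)] A.sa_add[OF x(2) y(2)]] by simp
  then show ?thesis using x y by (simp add: J_plus_j logmap_add algebra_simps)
qed

lemma J_scaleR: "J (r *\<^sub>R x) = r *\<^sub>R J x"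
proof -
  obtain h k where x: "A.sa h" "A.sa k" "x = h + jA * k" by (rule A.sa_decompose)
  have "r *\<^sub>R x = r *\<^sub>R h + jA * (r *\<^sub>R k)" by (simp add: x algebra_simps)
  then have "J (r *\<^sub>R x) = logmap (r *\<^sub>R h) + jB * logmap (r *\<^sub>R k)"
    by (simp only: J_plus_j[OF A.sa_scaleR[OF x(1)] A.sa_scaleR[OF x(2)]])
  then show ?thesis using x by (simp add: J_plus_j logmap_scaleR algebra_simps)
qed

lemma J_j: "J (jA * x) = jB * J x"
proof -
  obtain h k where x: "A.sa h" "A.sa k" "x = h + jA * k" by (rule A.sa_decompose)
  have "jA * x = - k + jA * h" by (simp add: x distrib_left A.j_j_mult)
  then have "J (jA * x) = logmap (- k) + jB * logmap h"
    by (simp only: J_plus_j[OF A.sa_minus[OF x(2)] x(1)])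
  then show ?thesis
    using x by (simp add: J_plus_j logmap_minus distrib_left B.j_j_mult)
qed

lemma J_mult: "J (x * y) = J x * J y"
proof -
  obtain h k where x: "A.sa h" "A.sa k" "x = h + jA * k" by (rule A.sa_decompose)
  obtain h' k' where y: "A.sa h'" "A.sa k'" "y = h' + jA * k'" by (rule A.sa_decompose)
  have jl: "a * (jA * b) = jA * (a * b)" "c * (jB * d) = jB * (c * d)" for a b c d
    by (metis mult_commute_A mult.assoc) (metis mult_commute_B mult.assoc)
  have "x * y = (h * h' - k * k') + jA * (h * k' + k * h')"
    unfolding x(3) y(3)
    by (simp add: distrib_left distrib_right mult.assoc jl(1)[of h] jl(1)[of k] A.j_j_mult)
  then have "J (x * y) = (logmap h * logmap h' - logmap k * logmap k') + jB * (logmap h * logmap k' + logmap k * logmap h')"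
    using x y by (simp add: J_plus_j sa_mult_A A.sa_add A.sa_diff logmap_add logmap_diff logmap_mult)
  then show ?thesis
    using x y by (simp add: J_plus_j distrib_left distrib_right mult.assoc jl(2)[of "logmap h"] jl(2)[of "logmap k"] B.j_j_mult)
qed

lemma J_st: "J (stA x) = stB (J x)"
proof -
  obtain h k where x: "A.sa h" "A.sa k" "x = h + jA * k" by (rule A.sa_decompose)
  have "stA x = h + jA * (- k)" using x by (simp add: A.st_add A.st_j_mult A.sa_st)
  then have "J (stA x) = logmap h + jB * logmap (- k)"
    by (simp only: J_plus_j[OF x(1) A.sa_minus[OF x(2)]])
  then show ?thesis
    using x by (simp add: J_plus_j logmap_minus B.st_add B.st_j_mult B.sa_st)
qed

lemma J_bij: "bij J"
proof (rule bijI)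
  show "inj J"
  proof (rule injI)
    fix x y assume "J x = J y"
    then have 0: "J (x - y) = 0" using J_add[of "x - y" y] by simp
    obtain h k where z: "A.sa h" "A.sa k" "x - y = h + jA * k" by (rule A.sa_decompose)
    then have "logmap h + jB * logmap k = 0" using 0 by (simp add: J_plus_j)
    then have "logmap h = 0" "logmap k = 0" using z B.sa_plus_j_eq_0 by blast+
    then have "h = 0" "k = 0" using logmap_eq_0 z by blast+
    then show "x = y" using z(3) by simp
  qed
  show "surj J"
  proof (rule surjI)
    fix y
    obtain h k where y: "B.sa h" "B.sa k" "y = h + jB * k" by (rule B.sa_decompose)
    obtain H K where "A.sa H" "logmap H = h" "A.sa K" "logmap K = k" using logmap_surj y by metis
    then have "\<exists>x. J x = y" using y J_plus_j by blast
    then show "J (SOME x. J x = y) = y" by (rule someI_ex)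
  qed
qed

lemma star_iso_J: "star_iso stA jA stB jB J"
  unfolding star_iso_def
  using J_bij J_add J_scaleR J_j J_mult J_st J_sa[of 1] by simp

text \<open>\<open>\<beta>\<close> times the image of the inverse of \<open>exp c0\<close>, the
  preimage of the scalar density.\<close>

definition C :: 'b where "C = \<beta> *\<^sub>R logmap (exp (- c0))"

lemma posinv_C: "B.posinv C"
  unfolding C_def using exp_c0(3) beta_pos
  by (subst logmap_exp) (auto intro!: B.posinv_scaleR B.posinv_exp)

text \<open>\<open>\<phi> X\<close> is \<open>\<beta>\<close> times the exponential of
  \<open>logmap (lg X - c0)\<close>, and \<open>logmap\<close> respects exponentials and
  products.\<close>

lemma phi_eq:
  assumes "X \<in> dens stA \<tau>"
  shows "\<phi> X = C * J X"
proof -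
  have X: "A.posinv X" "A.sa X" using assms by (auto simp: A.dens_iff)
  have s: "A.sa (A.lg X - c0)" using X exp_c0(3) by auto
  have "exp (A.lg X - c0) = exp (- c0) * X"
    using exp_add_commuting[OF mult_commute_A, of "- c0" "A.lg X"] X by simp
  then have "exp (logmap (A.lg X - c0)) = logmap (exp (- c0)) * logmap X"
    using logmap_exp[OF s] logmap_mult[of "exp (- c0)" X] X exp_c0(3) by (simp add: A.sa_exp A.sa_minus)
  then show ?thesis using logmap_of_dens(3)[OF assms] X by (simp add: J_sa C_def)
qed

text \<open>In the first moment at \<open>exp (- c0)\<close> the weight \<open>exp c0\<close>
  cancels; complex linearity extends this beyond self-adjoint elements.\<close>

lemma omega_C_J: "\<omega> (C * J X) = \<tau> X"
proof -
  have sa: "\<omega> (C * logmap h) = \<tau> h" if h: "A.sa h" for h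
  proof -
    have "\<beta> * B.T (logmap (exp (- c0)) * logmap h) = A.T (exp c0 * (exp (- c0) * h))"
      using logmap_trace_moments(1)[OF A.sa_exp[OF A.sa_minus[OF exp_c0(3)]] h] .
    then have "B.T (C * logmap h) = A.T h"
      by (simp add: C_def B.T_scaleR flip: mult.assoc)
    then show ?thesis
      using B.tau_sa_mult[of C "logmap h"] A.tau_sa[OF h] posinv_C h by auto
  qed
  obtain h k where x: "A.sa h" "A.sa k" "X = h + jA * k" by (rule A.sa_decompose)
  have "C * J X = C * logmap h + jB * (C * logmap k)"
    using x by (simp add: J_plus_j distrib_left) (metis mult_commute_B mult.assoc)
  then show ?thesis
    using x by (simp add: sa B.tau_add A.tau_add B.tau_j A.tau_j)
qed

lemma S_U_eq_S_BS:
  "X \<in> dens stA \<tau> \<Longrightarrow> Y \<in> dens stA \<tau> \<Longrightarrow> S_U stA \<tau> X Y = S_BS stA \<tau> X Y"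
  using bel_stas_eq_umegaki[of X Y] by (simp add: A.dens_iff A.S_U_eq A.S_BS_eq)

end

theorem theorem7:
  fixes stA :: "'a::{real_normed_algebra_1,banach} \<Rightarrow> 'a" and jA :: 'a
    and stB :: "'b::{real_normed_algebra_1,banach} \<Rightarrow> 'b" and jB :: 'b
    and \<tau> :: "'a \<Rightarrow> complex" and \<omega> :: "'b \<Rightarrow> complex"
    and \<phi> :: "'a \<Rightarrow> 'b"
  assumes "cstar_algebra stA jA" and "cstar_algebra stB jB"
    and "faithful_trace stA jA \<tau>" and "faithful_trace stB jB \<omega>"
    and "\<phi> ` dens stA \<tau> = dens stB \<omega>"
    and "\<forall>A\<in>dens stA \<tau>. \<forall>B\<in>dens stA \<tau>.
           S_U stB \<omega> (\<phi> A) (\<phi> B) = S_BS stA \<tau> A B"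
  shows "commutative_alg TYPE('a) \<and> commutative_alg TYPE('b)
    \<and> (\<forall>A\<in>dens stA \<tau>. \<forall>B\<in>dens stA \<tau>. S_U stA \<tau> A B = S_BS stA \<tau> A B)
    \<and> (\<exists>C J. cpos stB C \<and> cinvertible C \<and> (\<forall>y. C * y = y * C)
          \<and> star_iso stA jA stB jB J
          \<and> (\<forall>X. \<omega> (C * J X) = \<tau> X)
          \<and> (\<forall>A\<in>dens stA \<tau>. \<phi> A = C * J A))"
proof -
  interpret entropy_map stA jA \<tau> stB jB \<omega> \<phi>
    using assms by unfold_locales auto
  have "cpos stB C \<and> cinvertible C \<and> (\<forall>y. C * y = y * C) \<and> star_iso stA jA stB jB J
      \<and> (\<forall>X. \<omega> (C * J X) = \<tau> X) \<and> (\<forall>A\<in>dens stA \<tau>. \<phi> A = C * J A)"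
    using posinv_C mult_commute_B star_iso_J omega_C_J phi_eq by (auto simp: B.posinv_def)
  then show ?thesis
    using commutative_A commutative_B S_U_eq_S_BS by blast
qed

end
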